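(* A category is strongly compact if and only if it is (equivalent to) the category of models $\mathrm{Mod}(\mathcal{S})$ of a realized limit sketch $(\mathcal{E},\mathcal{S})$ such that every $\mathcal{S}$-model is small.
   Context: Conventions: categories are locally small unless otherwise stated; limits, colimits, cones and cocones are indexed by small categories; cocontinuous means preserving small colimits. A category $\mathcal{A}$ is strongly compact if every cocontinuous functor $\mathcal{A}\to\mathcal{B}$ into any category $\mathcal{B}$ is a left adjoint. A limit sketch $(\mathcal{E},\mathcal{S})$ consists of a (possibly large) category $\mathcal{E}$ and a (possibly large) class $\mathcal{S}$ of cones in $\mathcal{E}$, called distinguished cones. A model is a functor $\mathcal{E}\to\mathsf{Set}$ mapping every distinguished cone to a limit cone; $\mathrm{Mod}(\mathcal{S})\subseteq\mathrm{Hom}(\mathcal{E},\mathsf{Set})$ is the full subcategory of models. The sketch is realized if for every $A\in\mathcal{E}$ the functor $\mathrm{Hom}(A,-):\mathcal{E}\to\mathsf{Set}$ is a model (a "representable model"). A model of a realized limit sketch is small if it is a (small) colimit, taken inside $\mathrm{Mod}(\mathcal{S})$, of representable models. *)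

theory Defs
  imports Main "HOL-Library.FuncSet" "HOL-Library.Equipollence"
begin

text \<open>
  Size conventions. A type of class \<open>universe\<close> has strongly inaccessible cardinality, so it plays
  the part of a Grothendieck universe (or of the class of all sets, with limitation of size):
  a set is small iff it has strictly fewer elements than that type. Up to bijection, the small sets
  are exactly the small subsets of the universe itself.
\<close>

class universe =
  assumes infinity_small: "(UNIV :: nat set) \<prec> (UNIV :: 'a set)"
    and Pow_small: "\<And>X :: 'a set. X \<prec> (UNIV :: 'a set) \<Longrightarrow> Pow X \<prec> (UNIV :: 'a set)"
    and UN_small: "\<And>(I :: 'a set) (X :: 'a \<Rightarrow> 'a set).
      I \<prec> (UNIV :: 'a set) \<Longrightarrow> (\<And>i. i \<in> I \<Longrightarrow> X i \<prec> (UNIV :: 'a set))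
        \<Longrightarrow> (\<Union>i\<in>I. X i) \<prec> (UNIV :: 'a set)"

definition small :: "'u set \<Rightarrow> bool" where
  "small X \<longleftrightarrow> X \<prec> (UNIV :: 'u set)"


section \<open>Categories and functors\<close>

text \<open>
  Hom-sets of distinct pairs of objects need not be disjoint; this is why composition and the
  action of a functor on morphisms take the objects as arguments. \<open>Comp C a b c g f\<close> is the
  composite of \<open>f : a \<rightarrow> b\<close> and \<open>g : b \<rightarrow> c\<close>.
\<close>

record ('o, 'm) cat =
  Ob :: "'o set"
  Hom :: "'o \<Rightarrow> 'o \<Rightarrow> 'm set"
  Comp :: "'o \<Rightarrow> 'o \<Rightarrow> 'o \<Rightarrow> 'm \<Rightarrow> 'm \<Rightarrow> 'm"
  Ide :: "'o \<Rightarrow> 'm"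

definition is_category :: "('o, 'm) cat \<Rightarrow> bool" where
  "is_category C \<longleftrightarrow>
    (\<forall>a\<in>Ob C. Ide C a \<in> Hom C a a) \<and>
    (\<forall>a\<in>Ob C. \<forall>b\<in>Ob C. \<forall>c\<in>Ob C. \<forall>f\<in>Hom C a b. \<forall>g\<in>Hom C b c.
      Comp C a b c g f \<in> Hom C a c) \<and>
    (\<forall>a\<in>Ob C. \<forall>b\<in>Ob C. \<forall>f\<in>Hom C a b.
      Comp C a a b f (Ide C a) = f \<and> Comp C a b b (Ide C b) f = f) \<and>
    (\<forall>a\<in>Ob C. \<forall>b\<in>Ob C. \<forall>c\<in>Ob C. \<forall>d\<in>Ob C.
      \<forall>f\<in>Hom C a b. \<forall>g\<in>Hom C b c. \<forall>h\<in>Hom C c d.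
      Comp C a c d h (Comp C a b c g f) = Comp C a b d (Comp C b c d h g) f)"

text \<open>There is no size restriction on the objects.\<close>

definition locally_small :: "('o, 'u) cat \<Rightarrow> bool" where
  "locally_small C \<longleftrightarrow> (\<forall>a\<in>Ob C. \<forall>b\<in>Ob C. small (Hom C a b))"

definition small_category :: "('u, 'u) cat \<Rightarrow> bool" where
  "small_category J \<longleftrightarrow> is_category J \<and> locally_small J \<and> small (Ob J)"

definition is_iso :: "('o, 'm) cat \<Rightarrow> 'o \<Rightarrow> 'o \<Rightarrow> 'm \<Rightarrow> bool" where
  "is_iso C a b f \<longleftrightarrow> f \<in> Hom C a b \<and>
    (\<exists>g\<in>Hom C b a. Comp C a b a g f = Ide C a \<and> Comp C b a b f g = Ide C b)"

record ('o1, 'm1, 'o2, 'm2) fctr =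
  OMap :: "'o1 \<Rightarrow> 'o2"
  AMap :: "'o1 \<Rightarrow> 'o1 \<Rightarrow> 'm1 \<Rightarrow> 'm2"

definition is_functor ::
  "('o1, 'm1) cat \<Rightarrow> ('o2, 'm2) cat \<Rightarrow> ('o1, 'm1, 'o2, 'm2) fctr \<Rightarrow> bool" where
  "is_functor C D F \<longleftrightarrow> is_category C \<and> is_category D \<and>
    (\<forall>a\<in>Ob C. OMap F a \<in> Ob D) \<and>
    (\<forall>a\<in>Ob C. \<forall>b\<in>Ob C. \<forall>f\<in>Hom C a b. AMap F a b f \<in> Hom D (OMap F a) (OMap F b)) \<and>
    (\<forall>a\<in>Ob C. AMap F a a (Ide C a) = Ide D (OMap F a)) \<and>
    (\<forall>a\<in>Ob C. \<forall>b\<in>Ob C. \<forall>c\<in>Ob C. \<forall>f\<in>Hom C a b. \<forall>g\<in>Hom C b c.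
      AMap F a c (Comp C a b c g f) =
        Comp D (OMap F a) (OMap F b) (OMap F c) (AMap F b c g) (AMap F a b f))"

definition id_functor :: "('o, 'm, 'o, 'm) fctr" where
  "id_functor = \<lparr>OMap = (\<lambda>a. a), AMap = (\<lambda>a b f. f)\<rparr>"

definition comp_functor ::
  "('o2, 'm2, 'o3, 'm3) fctr \<Rightarrow> ('o1, 'm1, 'o2, 'm2) fctr \<Rightarrow> ('o1, 'm1, 'o3, 'm3) fctr" where
  "comp_functor G F =
    \<lparr>OMap = (\<lambda>a. OMap G (OMap F a)),
     AMap = (\<lambda>a b f. AMap G (OMap F a) (OMap F b) (AMap F a b f))\<rparr>"

definition nat_trans ::
  "('o1, 'm1) cat \<Rightarrow> ('o2, 'm2) cat \<Rightarrow> ('o1, 'm1, 'o2, 'm2) fctr \<Rightarrow> ('o1, 'm1, 'o2, 'm2) fctr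
    \<Rightarrow> ('o1 \<Rightarrow> 'm2) \<Rightarrow> bool" where
  "nat_trans C D F G \<alpha> \<longleftrightarrow>
    (\<forall>a\<in>Ob C. \<alpha> a \<in> Hom D (OMap F a) (OMap G a)) \<and>
    (\<forall>a\<in>Ob C. \<forall>b\<in>Ob C. \<forall>f\<in>Hom C a b.
      Comp D (OMap F a) (OMap F b) (OMap G b) (\<alpha> b) (AMap F a b f) =
      Comp D (OMap F a) (OMap G a) (OMap G b) (AMap G a b f) (\<alpha> a))"

definition naturally_isomorphic ::
  "('o1, 'm1) cat \<Rightarrow> ('o2, 'm2) cat \<Rightarrow> ('o1, 'm1, 'o2, 'm2) fctr \<Rightarrow> ('o1, 'm1, 'o2, 'm2) fctr
    \<Rightarrow> bool" where
  "naturally_isomorphic C D F G \<longleftrightarrow>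
    (\<exists>\<alpha>. nat_trans C D F G \<alpha> \<and> (\<forall>a\<in>Ob C. is_iso D (OMap F a) (OMap G a) (\<alpha> a)))"

definition equivalent_categories :: "('o1, 'm1) cat \<Rightarrow> ('o2, 'm2) cat \<Rightarrow> bool" where
  "equivalent_categories C D \<longleftrightarrow> (\<exists>F G. is_functor C D F \<and> is_functor D C G \<and>
    naturally_isomorphic C C (comp_functor G F) id_functor \<and>
    naturally_isomorphic D D (comp_functor F G) id_functor)"

definition is_left_adjoint ::
  "('o1, 'm1) cat \<Rightarrow> ('o2, 'm2) cat \<Rightarrow> ('o1, 'm1, 'o2, 'm2) fctr \<Rightarrow> bool" where
  "is_left_adjoint C D F \<longleftrightarrow> is_functor C D F \<and>
    (\<exists>G \<phi>. is_functor D C G \<and>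
      (\<forall>a\<in>Ob C. \<forall>b\<in>Ob D. bij_betw (\<phi> a b) (Hom D (OMap F a) b) (Hom C a (OMap G b))) \<and>
      (\<forall>a\<in>Ob C. \<forall>a'\<in>Ob C. \<forall>b\<in>Ob D. \<forall>f\<in>Hom C a' a. \<forall>h\<in>Hom D (OMap F a) b.
        \<phi> a' b (Comp D (OMap F a') (OMap F a) b h (AMap F a' a f)) =
        Comp C a' a (OMap G b) (\<phi> a b h) f) \<and>
      (\<forall>a\<in>Ob C. \<forall>b\<in>Ob D. \<forall>b'\<in>Ob D. \<forall>g\<in>Hom D b b'. \<forall>h\<in>Hom D (OMap F a) b.
        \<phi> a b' (Comp D (OMap F a) b b' g h) =
        Comp C a (OMap G b) (OMap G b') (AMap G b b' g) (\<phi> a b h)))"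


section \<open>Small limits and colimits\<close>

text \<open>
  The index category \<open>J\<close> is always small. Taking its objects and morphisms in the universe \<open>'u\<close>
  is no restriction up to isomorphism.
\<close>

definition is_cone ::
  "('o, 'm) cat \<Rightarrow> ('u, 'u) cat \<Rightarrow> ('u, 'u, 'o, 'm) fctr \<Rightarrow> 'o \<Rightarrow> ('u \<Rightarrow> 'm) \<Rightarrow> bool" where
  "is_cone C J D a p \<longleftrightarrow> small_category J \<and> is_functor J C D \<and> a \<in> Ob C \<and>
    (\<forall>j\<in>Ob J. p j \<in> Hom C a (OMap D j)) \<and>
    (\<forall>i\<in>Ob J. \<forall>j\<in>Ob J. \<forall>u\<in>Hom J i j.
      Comp C a (OMap D i) (OMap D j) (AMap D i j u) (p i) = p j)"

definition is_limit_cone ::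
  "('o, 'm) cat \<Rightarrow> ('u, 'u) cat \<Rightarrow> ('u, 'u, 'o, 'm) fctr \<Rightarrow> 'o \<Rightarrow> ('u \<Rightarrow> 'm) \<Rightarrow> bool" where
  "is_limit_cone C J D a p \<longleftrightarrow> is_cone C J D a p \<and>
    (\<forall>b q. is_cone C J D b q \<longrightarrow>
      (\<exists>!h. h \<in> Hom C b a \<and> (\<forall>j\<in>Ob J. Comp C b a (OMap D j) (p j) h = q j)))"

definition is_cocone ::
  "('o, 'm) cat \<Rightarrow> ('u, 'u) cat \<Rightarrow> ('u, 'u, 'o, 'm) fctr \<Rightarrow> 'o \<Rightarrow> ('u \<Rightarrow> 'm) \<Rightarrow> bool" where
  "is_cocone C J D a p \<longleftrightarrow> small_category J \<and> is_functor J C D \<and> a \<in> Ob C \<and>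
    (\<forall>j\<in>Ob J. p j \<in> Hom C (OMap D j) a) \<and>
    (\<forall>i\<in>Ob J. \<forall>j\<in>Ob J. \<forall>u\<in>Hom J i j.
      Comp C (OMap D i) (OMap D j) a (p j) (AMap D i j u) = p i)"

definition is_colimit_cocone ::
  "('o, 'm) cat \<Rightarrow> ('u, 'u) cat \<Rightarrow> ('u, 'u, 'o, 'm) fctr \<Rightarrow> 'o \<Rightarrow> ('u \<Rightarrow> 'm) \<Rightarrow> bool" where
  "is_colimit_cocone C J D a p \<longleftrightarrow> is_cocone C J D a p \<and>
    (\<forall>b q. is_cocone C J D b q \<longrightarrow>
      (\<exists>!h. h \<in> Hom C a b \<and> (\<forall>j\<in>Ob J. Comp C (OMap D j) a b h (p j) = q j)))"

text \<open>Only those colimits that exist in \<open>C\<close> have to be preserved; \<open>C\<close> need not be cocomplete.\<close>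

definition cocontinuous ::
  "('o1, 'm1) cat \<Rightarrow> ('o2, 'u) cat \<Rightarrow> ('o1, 'm1, 'o2, 'u) fctr \<Rightarrow> bool" where
  "cocontinuous C B F \<longleftrightarrow> is_functor C B F \<and>
    (\<forall>(J :: ('u, 'u) cat) D a p. is_colimit_cocone C J D a p \<longrightarrow>
      is_colimit_cocone B J (comp_functor F D) (OMap F a) (\<lambda>j. AMap F (OMap D j) a (p j)))"

text \<open>
  The type \<open>'o\<close> is the ambient collection from which the objects of (possibly large) categories
  are taken.
\<close>

definition strongly_compact :: "('o, 'u) cat \<Rightarrow> bool" where
  "strongly_compact A \<longleftrightarrow>
    (\<forall>(B :: ('o, 'u) cat) F. is_category B \<and> locally_small B \<and> cocontinuous A B F
      \<longrightarrow> is_left_adjoint A B F)"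


section \<open>Sets, functor categories and limit sketches\<close>

definition SetCat :: "('u set, 'u \<Rightarrow> 'u) cat" where
  "SetCat = \<lparr>Ob = {X. small X}, Hom = (\<lambda>X Y. X \<rightarrow>\<^sub>E Y),
    Comp = (\<lambda>X Y Z g f. compose X g f), Ide = (\<lambda>X. \<lambda>x\<in>X. x)\<rparr>"

text \<open>
  Natural transformations are taken extensional, so that equality of morphisms is equality of all
  components. Functors are not: two functors that agree on \<open>C\<close> but differ as records are isomorphic
  objects of the functor category.
\<close>

definition functor_category ::
  "('o1, 'm1) cat \<Rightarrow> ('o2, 'm2) cat \<Rightarrow> (('o1, 'm1, 'o2, 'm2) fctr, 'o1 \<Rightarrow> 'm2) cat" where
  "functor_category C D =
    \<lparr>Ob = {F. is_functor C D F},
     Hom = (\<lambda>F G. {\<alpha> \<in> extensional (Ob C). nat_trans C D F G \<alpha>}),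
     Comp = (\<lambda>F G H \<beta> \<alpha>. \<lambda>a\<in>Ob C. Comp D (OMap F a) (OMap G a) (OMap H a) (\<beta> a) (\<alpha> a)),
     Ide = (\<lambda>F. \<lambda>a\<in>Ob C. Ide D (OMap F a))\<rparr>"

definition full_subcategory :: "('o, 'm) cat \<Rightarrow> ('o \<Rightarrow> bool) \<Rightarrow> ('o, 'm) cat" where
  "full_subcategory C P = C\<lparr>Ob := {a \<in> Ob C. P a}\<rparr>"

definition hom_functor :: "('o, 'u) cat \<Rightarrow> 'o \<Rightarrow> ('o, 'u, 'u set, 'u \<Rightarrow> 'u) fctr" where
  "hom_functor E a =
    \<lparr>OMap = (\<lambda>b. Hom E a b),
     AMap = (\<lambda>b c f. \<lambda>g\<in>Hom E a b. Comp E a b c f g)\<rparr>"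

text \<open>A cone is given by its index category, its diagram, its apex and its legs.\<close>

type_synonym ('o, 'u) cone = "('u, 'u) cat \<times> ('u, 'u, 'o, 'u) fctr \<times> 'o \<times> ('u \<Rightarrow> 'u)"

definition limit_sketch :: "('o, 'u) cat \<Rightarrow> ('o, 'u) cone set \<Rightarrow> bool" where
  "limit_sketch E S \<longleftrightarrow> is_category E \<and> locally_small E \<and>
    (\<forall>(J, D, a, p) \<in> S. is_cone E J D a p)"

definition is_model ::
  "('o, 'u) cat \<Rightarrow> ('o, 'u) cone set \<Rightarrow> ('o, 'u, 'u set, 'u \<Rightarrow> 'u) fctr \<Rightarrow> bool" where
  "is_model E S M \<longleftrightarrow> is_functor E SetCat M \<and>
    (\<forall>(J, D, a, p) \<in> S.
      is_limit_cone SetCat J (comp_functor M D) (OMap M a) (\<lambda>j. AMap M a (OMap D j) (p j)))"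

definition Mod ::
  "('o, 'u) cat \<Rightarrow> ('o, 'u) cone set
    \<Rightarrow> (('o, 'u, 'u set, 'u \<Rightarrow> 'u) fctr, 'o \<Rightarrow> 'u \<Rightarrow> 'u) cat" where
  "Mod E S = full_subcategory (functor_category E SetCat) (is_model E S)"

definition realized :: "('o, 'u) cat \<Rightarrow> ('o, 'u) cone set \<Rightarrow> bool" where
  "realized E S \<longleftrightarrow> (\<forall>a\<in>Ob E. is_model E S (hom_functor E a))"

definition small_model ::
  "('o, 'u) cat \<Rightarrow> ('o, 'u) cone set \<Rightarrow> ('o, 'u, 'u set, 'u \<Rightarrow> 'u) fctr \<Rightarrow> bool" where
  "small_model E S M \<longleftrightarrow>
    (\<exists>(J :: ('u, 'u) cat) D p. is_colimit_cocone (Mod E S) J D M p \<and>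
      (\<forall>j\<in>Ob J. \<exists>a\<in>Ob E. OMap D j = hom_functor E a))"

end

theory Submission imports Defs begin

text \<open>
  Two constructions carry the proof, one for each direction.

  Let \<open>A\<close> be strongly compact, and take for \<open>E\<close> the opposite category of \<open>A\<close> and for \<open>S\<close> all limit
  cones of \<open>E\<close>, that is, all small colimits that exist in \<open>A\<close>. Hom functors preserve limits, so this
  sketch is realized. A model \<open>M\<close> is the same thing as a cocontinuous functor from \<open>A\<close> to the opposite
  of the category of sets. If it is a left adjoint, with right adjoint \<open>G\<close>, then
  \<open>M a = Hom(1, M a)\<close> is naturally \<open>Hom A a (G 1)\<close> for a one-point set \<open>1\<close>, and \<open>M\<close> is representable.
  Hence the Yoneda embedding of \<open>A\<close> into the models is an equivalence, and each model is isomorphic to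
  a representable one, which makes it a colimit over the one-point index category. The opposite of the
  category of sets is not itself an admissible test category for strong compactness, as its objects
  are sets and its morphisms functions; but only the sets \<open>M a\<close> and \<open>1\<close> matter, and the functions
  between two small sets can be renamed to elements of the universe
  (\<open>strongly_compact_representable\<close>).

  Conversely, let \<open>A\<close> be the category of models of a realized sketch, and write \<open>y\<close> for the Yoneda
  embedding. It maps each distinguished cone to a colimit cocone of models (\<open>yoneda_colimit\<close>): morphisms
  from \<open>y a\<close> to \<open>M\<close> are elements of \<open>M a\<close>, and \<open>M\<close> maps the cone to a limit. If \<open>F\<close> is cocontinuous,
  then \<open>N e = Hom(F (y e), b)\<close> is therefore again a model. By the Yoneda lemma,
  \<open>Hom(F M, b)\<close> and \<open>Hom(M, N)\<close> agree for representable \<open>M\<close>, and both turn colimits in \<open>M\<close> into limits,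
  so they agree for every small \<open>M\<close> (\<open>Mod_universal_arrow\<close>). If all models are small, \<open>b \<mapsto> N\<close> is thus
  right adjoint to \<open>F\<close>.

  Adjoints are handled through universal arrows, and equivalences through fully faithful and
  essentially surjective functors. Universal arrows do most of the work for both, because choosing
  one for each object already gives a functor (\<open>universal_arrows_functor\<close>).
\<close>

section \<open>Small sets\<close>

lemma small_lepoll: "X \<lesssim> Y \<Longrightarrow> small Y \<Longrightarrow> X \<prec> (UNIV :: 'u set)" for Y :: "'u set"
  unfolding small_def by (rule lesspoll_trans1)

lemma infinite_universe: "infinite (UNIV :: 'u::universe set)"
  using infinity_small[where 'a='u] by (simp add: infinite_le_lepoll lesspoll_imp_lepoll)

lemma small_finite: "finite X \<Longrightarrow> small (X :: 'u::universe set)"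
  unfolding small_def using infinite_universe finite_lesspoll_infinite by blast

text \<open>A function with small domain and codomain is determined by its graph, and after a choice
  of pairing of the infinite universe all these graphs are subsets of one small set.\<close>

lemma small_function_space:
  fixes X Y :: "'u::universe set"
  assumes X: "small X" and Y: "small Y"
  shows "(X \<rightarrow>\<^sub>E Y) \<prec> (UNIV :: 'u set)"
proof -
  have "(UNIV :: 'u set) \<times> (UNIV :: 'u set) \<approx> (UNIV :: 'u set)"
    using card_of_Times_same_infinite[OF infinite_universe] by (simp add: eqpoll_iff_card_of_ordIso)
  then obtain pr :: "'u \<times> 'u \<Rightarrow> 'u" where pr: "inj pr"
    unfolding eqpoll_def bij_betw_def by auto
  define P where "P = (\<Union>x\<in>X. (\<lambda>y. pr (x, y)) ` Y)"
  have "P \<prec> (UNIV :: 'u set)"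
    unfolding P_def
    using X Y small_lepoll[OF image_lepoll] by (intro UN_small) (auto simp: small_def)
  then have PP: "Pow P \<prec> (UNIV :: 'u set)"
    by (rule Pow_small)
  have "inj_on (\<lambda>f. (\<lambda>x. pr (x, f x)) ` X) (X \<rightarrow>\<^sub>E Y)"
  proof (rule inj_onI)
    fix f g assume f: "f \<in> X \<rightarrow>\<^sub>E Y" and g: "g \<in> X \<rightarrow>\<^sub>E Y"
      and eq: "(\<lambda>x. pr (x, f x)) ` X = (\<lambda>x. pr (x, g x)) ` X"
    have "f x = g x" if "x \<in> X" for x
    proof -
      have "pr (x, f x) \<in> (\<lambda>x. pr (x, g x)) ` X" using eq that by blast
      then obtain y where "pr (x, f x) = pr (y, g y)" by blast
      then show ?thesis using injD[OF pr] by blast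
    qed
    then show "f = g" using f g by (auto intro: PiE_ext)
  qed
  moreover have "(\<lambda>f. (\<lambda>x. pr (x, f x)) ` X) ` (X \<rightarrow>\<^sub>E Y) \<subseteq> Pow P"
    by (auto simp: P_def)
  ultimately have "(X \<rightarrow>\<^sub>E Y) \<lesssim> Pow P"
    unfolding lepoll_def by blast
  then show ?thesis using PP lesspoll_trans1 by blast
qed

section \<open>Categories and functors\<close>

lemma cat_Ide: "is_category C \<Longrightarrow> a \<in> Ob C \<Longrightarrow> Ide C a \<in> Hom C a a"
  by (simp add: is_category_def)

lemma cat_Comp:
  "is_category C \<Longrightarrow> a \<in> Ob C \<Longrightarrow> b \<in> Ob C \<Longrightarrow> c \<in> Ob C \<Longrightarrow> f \<in> Hom C a b \<Longrightarrow> g \<in> Hom C b c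
    \<Longrightarrow> Comp C a b c g f \<in> Hom C a c"
  by (simp add: is_category_def)

lemma cat_idr:
  "is_category C \<Longrightarrow> a \<in> Ob C \<Longrightarrow> b \<in> Ob C \<Longrightarrow> f \<in> Hom C a b \<Longrightarrow> Comp C a a b f (Ide C a) = f"
  by (simp add: is_category_def)

lemma cat_idl:
  "is_category C \<Longrightarrow> a \<in> Ob C \<Longrightarrow> b \<in> Ob C \<Longrightarrow> f \<in> Hom C a b \<Longrightarrow> Comp C a b b (Ide C b) f = f"
  by (simp add: is_category_def)

lemma cat_assoc:
  "is_category C \<Longrightarrow> a \<in> Ob C \<Longrightarrow> b \<in> Ob C \<Longrightarrow> c \<in> Ob C \<Longrightarrow> d \<in> Ob C
    \<Longrightarrow> f \<in> Hom C a b \<Longrightarrow> g \<in> Hom C b c \<Longrightarrow> h \<in> Hom C c d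
    \<Longrightarrow> Comp C a c d h (Comp C a b c g f) = Comp C a b d (Comp C b c d h g) f"
  unfolding is_category_def by blast

lemma functor_dom: "is_functor C D F \<Longrightarrow> is_category C"
  by (simp add: is_functor_def)

lemma functor_cod: "is_functor C D F \<Longrightarrow> is_category D"
  by (simp add: is_functor_def)

lemma functor_Ob: "is_functor C D F \<Longrightarrow> a \<in> Ob C \<Longrightarrow> OMap F a \<in> Ob D"
  by (simp add: is_functor_def)

lemma functor_Hom:
  "is_functor C D F \<Longrightarrow> a \<in> Ob C \<Longrightarrow> b \<in> Ob C \<Longrightarrow> f \<in> Hom C a b
    \<Longrightarrow> AMap F a b f \<in> Hom D (OMap F a) (OMap F b)"
  by (simp add: is_functor_def)

lemma functor_Ide: "is_functor C D F \<Longrightarrow> a \<in> Ob C \<Longrightarrow> AMap F a a (Ide C a) = Ide D (OMap F a)"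
  by (simp add: is_functor_def)

lemma functor_Comp:
  "is_functor C D F \<Longrightarrow> a \<in> Ob C \<Longrightarrow> b \<in> Ob C \<Longrightarrow> c \<in> Ob C \<Longrightarrow> f \<in> Hom C a b \<Longrightarrow> g \<in> Hom C b c
    \<Longrightarrow> AMap F a c (Comp C a b c g f) =
        Comp D (OMap F a) (OMap F b) (OMap F c) (AMap F b c g) (AMap F a b f)"
  unfolding is_functor_def by blast

lemma comp_functor_simps [simp]:
  "OMap (comp_functor G F) a = OMap G (OMap F a)"
  "AMap (comp_functor G F) a b f = AMap G (OMap F a) (OMap F b) (AMap F a b f)"
  by (simp_all add: comp_functor_def)

lemma comp_functor_assoc:
  "comp_functor (comp_functor H G) F = comp_functor H (comp_functor G F)"
  by (simp add: comp_functor_def)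

lemma id_functor_simps [simp]: "OMap id_functor a = a" "AMap id_functor a b f = f"
  by (simp_all add: id_functor_def)

lemma comp_functor_is_functor:
  assumes F: "is_functor C D F" and G: "is_functor D E G"
  shows "is_functor C E (comp_functor G F)"
  unfolding is_functor_def
  by (simp add: functor_dom[OF F] functor_cod[OF G] functor_Ob[OF F] functor_Ob[OF G]
      functor_Hom[OF F] functor_Hom[OF G] functor_Ide[OF F] functor_Ide[OF G]
      functor_Comp[OF F] functor_Comp[OF G])

section \<open>Duality\<close>

definition op :: "('o, 'm) cat \<Rightarrow> ('o, 'm) cat" where
  "op C = \<lparr>Ob = Ob C, Hom = (\<lambda>a b. Hom C b a), Comp = (\<lambda>a b c g f. Comp C c b a f g), Ide = Ide C\<rparr>"

definition op_functor :: "('o1, 'm1, 'o2, 'm2) fctr \<Rightarrow> ('o1, 'm1, 'o2, 'm2) fctr" where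
  "op_functor F = \<lparr>OMap = OMap F, AMap = (\<lambda>a b f. AMap F b a f)\<rparr>"

lemma op_simps [simp]:
  "Ob (op C) = Ob C" "Hom (op C) a b = Hom C b a" "Comp (op C) a b c g f = Comp C c b a f g"
  "Ide (op C) = Ide C"
  by (simp_all add: op_def)

lemma op_functor_simps [simp]:
  "OMap (op_functor F) a = OMap F a" "AMap (op_functor F) a b f = AMap F b a f"
  by (simp_all add: op_functor_def)

lemma op_op [simp]: "op (op C) = C"
  by (simp add: op_def)

lemma op_functor_op_functor [simp]: "op_functor (op_functor F) = F"
  by (simp add: op_functor_def)

lemma op_functor_comp: "op_functor (comp_functor G F) = comp_functor (op_functor G) (op_functor F)"
  by (simp add: op_functor_def comp_functor_def)

lemma op_category: "is_category C \<Longrightarrow> is_category (op C)"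
  unfolding is_category_def op_simps by (intro conjI ballI) metis+

lemma op_locally_small: "locally_small C \<Longrightarrow> locally_small (op C)"
  by (simp add: locally_small_def)

lemma op_small_category: "small_category J \<Longrightarrow> small_category (op J)"
  by (simp add: small_category_def op_category op_locally_small)

lemma op_functor_is_functor: "is_functor C D F \<Longrightarrow> is_functor (op C) (op D) (op_functor F)"
  unfolding is_functor_def using op_category[of C] op_category[of D] by simp

lemma op_small_category_iff: "small_category (op J) \<longleftrightarrow> small_category J"
  using op_small_category[of J] op_small_category[of "op J"] by auto

lemma op_functor_is_functor_iff:
  "is_functor (op C) (op D) (op_functor F) \<longleftrightarrow> is_functor C D F"
  using op_functor_is_functor[of C D F] op_functor_is_functor[of "op C" "op D" "op_functor F"]
  by auto

lemma op_cocone: "is_cocone (op C) (op J) (op_functor D) a p \<longleftrightarrow> is_cone C J D a p"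
  unfolding is_cocone_def is_cone_def op_small_category_iff op_functor_is_functor_iff by auto

lemma op_colimit_cocone:
  "is_colimit_cocone (op C) (op J) (op_functor D) a p \<longleftrightarrow> is_limit_cone C J D a p"
  unfolding is_colimit_cocone_def is_limit_cone_def op_cocone by simp

lemma op_limit_cone:
  "is_limit_cone (op C) (op J) (op_functor D) a p \<longleftrightarrow> is_colimit_cocone C J D a p"
  using op_colimit_cocone[of "op C" "op J" "op_functor D" a p] by simp

section \<open>Colimits\<close>

lemma colimit_cocone: "is_colimit_cocone C J D a p \<Longrightarrow> is_cocone C J D a p"
  by (simp add: is_colimit_cocone_def)

lemma limit_cone: "is_limit_cone C J D a p \<Longrightarrow> is_cone C J D a p"
  by (simp add: is_limit_cone_def)

lemma coconeD:
  assumes "is_cocone C J D a p"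
  shows "small_category J" "is_functor J C D" "a \<in> Ob C"
    "\<And>j. j \<in> Ob J \<Longrightarrow> p j \<in> Hom C (OMap D j) a"
    "\<And>i j u. i \<in> Ob J \<Longrightarrow> j \<in> Ob J \<Longrightarrow> u \<in> Hom J i j
      \<Longrightarrow> Comp C (OMap D i) (OMap D j) a (p j) (AMap D i j u) = p i"
  using assms unfolding is_cocone_def by auto

lemma coneD:
  assumes "is_cone C J D a p"
  shows "small_category J" "is_functor J C D" "a \<in> Ob C"
    "\<And>j. j \<in> Ob J \<Longrightarrow> p j \<in> Hom C a (OMap D j)"
    "\<And>i j u. i \<in> Ob J \<Longrightarrow> j \<in> Ob J \<Longrightarrow> u \<in> Hom J i j
      \<Longrightarrow> Comp C a (OMap D i) (OMap D j) (AMap D i j u) (p i) = p j"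
  using assms unfolding is_cone_def by auto

lemma colimit_factor:
  assumes "is_colimit_cocone C J D a p" "is_cocone C J D b q"
  obtains h where "h \<in> Hom C a b" "\<And>j. j \<in> Ob J \<Longrightarrow> Comp C (OMap D j) a b h (p j) = q j"
  using assms unfolding is_colimit_cocone_def by blast

lemma cocone_postcomp:
  assumes p: "is_cocone C J D a p" and b: "b \<in> Ob C" and h: "h \<in> Hom C a b"
  shows "is_cocone C J D b (\<lambda>j. Comp C (OMap D j) a b h (p j))"
proof -
  note p = coconeD[OF p]
  note C = functor_cod[OF p(2)]
  show ?thesis
    unfolding is_cocone_def
  proof (intro conjI ballI)
    fix i j u assume ij: "i \<in> Ob J" "j \<in> Ob J" "u \<in> Hom J i j"
    show "Comp C (OMap D i) (OMap D j) b (Comp C (OMap D j) a b h (p j)) (AMap D i j u) =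
        Comp C (OMap D i) a b h (p i)"
      using ij p(3-5) b h C functor_Ob[OF p(2)] functor_Hom[OF p(2)]
      by (simp flip: cat_assoc)
  qed (use p b h C functor_Ob[OF p(2)] in \<open>auto intro!: cat_Comp\<close>)
qed

lemma colimit_jointly_epi:
  assumes p: "is_colimit_cocone C J D a p" and b: "b \<in> Ob C"
    and g: "g \<in> Hom C a b" and h: "h \<in> Hom C a b"
    and eq: "\<And>j. j \<in> Ob J \<Longrightarrow> Comp C (OMap D j) a b g (p j) = Comp C (OMap D j) a b h (p j)"
  shows "g = h"
proof -
  have "is_cocone C J D b (\<lambda>j. Comp C (OMap D j) a b h (p j))"
    using cocone_postcomp[OF colimit_cocone[OF p] b h] .
  then have "\<exists>!k. k \<in> Hom C a b \<and>
      (\<forall>j\<in>Ob J. Comp C (OMap D j) a b k (p j) = Comp C (OMap D j) a b h (p j))"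
    using p unfolding is_colimit_cocone_def by blast
  then show ?thesis using g h eq by blast
qed

lemma colimit_coconeI:
  assumes p: "is_cocone C J D a p"
    and ex: "\<And>b q. is_cocone C J D b q \<Longrightarrow>
      \<exists>h\<in>Hom C a b. \<forall>j\<in>Ob J. Comp C (OMap D j) a b h (p j) = q j"
    and un: "\<And>b g h. b \<in> Ob C \<Longrightarrow> g \<in> Hom C a b \<Longrightarrow> h \<in> Hom C a b \<Longrightarrow>
      (\<And>j. j \<in> Ob J \<Longrightarrow> Comp C (OMap D j) a b g (p j) = Comp C (OMap D j) a b h (p j)) \<Longrightarrow> g = h"
  shows "is_colimit_cocone C J D a p"
  unfolding is_colimit_cocone_def
proof (intro conjI allI impI)
  fix b q assume q: "is_cocone C J D b q"
  obtain h where h: "h \<in> Hom C a b" "\<forall>j\<in>Ob J. Comp C (OMap D j) a b h (p j) = q j"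
    using ex[OF q] by blast
  show "\<exists>!h. h \<in> Hom C a b \<and> (\<forall>j\<in>Ob J. Comp C (OMap D j) a b h (p j) = q j)"
    using h un[OF coconeD(3)[OF q]] by (intro ex1I[of _ h]) auto
qed (rule p)

lemma functor_cocone:
  assumes F: "is_functor C B F" and p: "is_cocone C J D a p"
  shows "is_cocone B J (comp_functor F D) (OMap F a) (\<lambda>j. AMap F (OMap D j) a (p j))"
proof -
  note p = coconeD[OF p]
  show ?thesis
    unfolding is_cocone_def
  proof (intro conjI ballI)
    fix i j u assume ij: "i \<in> Ob J" "j \<in> Ob J" "u \<in> Hom J i j"
    have "AMap F (OMap D i) a (Comp C (OMap D i) (OMap D j) a (p j) (AMap D i j u)) =
        AMap F (OMap D i) a (p i)"
      using ij p(5) by simp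
    then show "Comp B (OMap (comp_functor F D) i) (OMap (comp_functor F D) j) (OMap F a)
        (AMap F (OMap D j) a (p j)) (AMap (comp_functor F D) i j u) = AMap F (OMap D i) a (p i)"
      using ij p(3,4) functor_Ob[OF p(2)] functor_Hom[OF p(2)]
      by (simp add: functor_Comp[OF F])
  qed (use p F comp_functor_is_functor[OF p(2) F] functor_Ob[OF p(2)] functor_Ob[OF F]
      functor_Hom[OF F] in auto)
qed

section \<open>Fully faithful functors and equivalences\<close>

lemma isoE:
  assumes "is_iso C a b f"
  obtains g where "f \<in> Hom C a b" "g \<in> Hom C b a"
    "Comp C a b a g f = Ide C a" "Comp C b a b f g = Ide C b"
  using assms unfolding is_iso_def by blast

lemma iso_mono:
  assumes C: "is_category C" and a: "a \<in> Ob C" and b: "b \<in> Ob C" and c: "c \<in> Ob C"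
    and i: "is_iso C b c i" and f: "f \<in> Hom C a b" and g: "g \<in> Hom C a b"
    and eq: "Comp C a b c i f = Comp C a b c i g"
  shows "f = g"
proof -
  obtain j where ij: "i \<in> Hom C b c" "j \<in> Hom C c b" "Comp C b c b j i = Ide C b"
    using i by (rule isoE)
  have "Comp C a c b j (Comp C a b c i f) = Comp C a c b j (Comp C a b c i g)"
    using eq by simp
  then show ?thesis by (simp add: cat_assoc[OF C a b c b] ij cat_idl[OF C a b] f g)
qed

lemma iso_epi:
  assumes C: "is_category C" and a: "a \<in> Ob C" and b: "b \<in> Ob C" and c: "c \<in> Ob C"
    and i: "is_iso C a b i" and f: "f \<in> Hom C b c" and g: "g \<in> Hom C b c"
    and eq: "Comp C a b c f i = Comp C a b c g i"
  shows "f = g"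
proof -
  obtain j where ij: "i \<in> Hom C a b" "j \<in> Hom C b a" "Comp C b a b i j = Ide C b"
    using i by (rule isoE)
  have "Comp C b a c (Comp C a b c f i) j = Comp C b a c (Comp C a b c g i) j"
    using eq by simp
  then show ?thesis by (simp add: cat_assoc[OF C b a b c, symmetric] ij cat_idr[OF C b c] f g)
qed

definition fully_faithful ::
  "('o1, 'm1) cat \<Rightarrow> ('o2, 'm2) cat \<Rightarrow> ('o1, 'm1, 'o2, 'm2) fctr \<Rightarrow> bool" where
  "fully_faithful C D F \<longleftrightarrow> is_functor C D F \<and>
    (\<forall>a\<in>Ob C. \<forall>b\<in>Ob C. bij_betw (AMap F a b) (Hom C a b) (Hom D (OMap F a) (OMap F b)))"

definition essentially_surjective ::
  "('o1, 'm1) cat \<Rightarrow> ('o2, 'm2) cat \<Rightarrow> ('o1, 'm1, 'o2, 'm2) fctr \<Rightarrow> bool" where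
  "essentially_surjective C D F \<longleftrightarrow> (\<forall>d\<in>Ob D. \<exists>c\<in>Ob C. \<exists>i. is_iso D (OMap F c) d i)"

lemma ff_functor: "fully_faithful C D F \<Longrightarrow> is_functor C D F"
  by (simp add: fully_faithful_def)

lemma ff_inj:
  "fully_faithful C D F \<Longrightarrow> a \<in> Ob C \<Longrightarrow> b \<in> Ob C \<Longrightarrow> f \<in> Hom C a b \<Longrightarrow> g \<in> Hom C a b
    \<Longrightarrow> AMap F a b f = AMap F a b g \<Longrightarrow> f = g"
  by (rule inj_onD[of "AMap F a b" "Hom C a b"]) (simp_all add: fully_faithful_def bij_betw_def)

lemma ff_lift:
  assumes "fully_faithful C D F" "a \<in> Ob C" "b \<in> Ob C" "g \<in> Hom D (OMap F a) (OMap F b)"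
  obtains f where "f \<in> Hom C a b" "AMap F a b f = g"
proof -
  have "g \<in> AMap F a b ` Hom C a b"
    using assms unfolding fully_faithful_def bij_betw_def by blast
  then show thesis using that by blast
qed

lemma fully_faithfulI:
  assumes F: "is_functor C D F"
    and inj: "\<And>a b f g. a \<in> Ob C \<Longrightarrow> b \<in> Ob C \<Longrightarrow> f \<in> Hom C a b \<Longrightarrow> g \<in> Hom C a b
      \<Longrightarrow> AMap F a b f = AMap F a b g \<Longrightarrow> f = g"
    and surj: "\<And>a b g. a \<in> Ob C \<Longrightarrow> b \<in> Ob C \<Longrightarrow> g \<in> Hom D (OMap F a) (OMap F b)
      \<Longrightarrow> \<exists>f\<in>Hom C a b. AMap F a b f = g"
  shows "fully_faithful C D F"
  unfolding fully_faithful_def bij_betw_def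
proof (intro conjI ballI)
  fix a b assume ab: "a \<in> Ob C" "b \<in> Ob C"
  show "inj_on (AMap F a b) (Hom C a b)" using inj[OF ab] by (auto intro: inj_onI)
  show "AMap F a b ` Hom C a b = Hom D (OMap F a) (OMap F b)"
    using surj[OF ab] functor_Hom[OF F ab] by blast
qed (rule F)

lemma ff_reflects_iso:
  assumes F: "fully_faithful C D F" and ab: "a \<in> Ob C" "b \<in> Ob C" and f: "f \<in> Hom C a b"
    and i: "is_iso D (OMap F a) (OMap F b) (AMap F a b f)"
  shows "is_iso C a b f"
proof -
  note Ff = ff_functor[OF F]
  note C = functor_dom[OF Ff]
  obtain g' where g': "g' \<in> Hom D (OMap F b) (OMap F a)"
    "Comp D (OMap F a) (OMap F b) (OMap F a) g' (AMap F a b f) = Ide D (OMap F a)"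
    "Comp D (OMap F b) (OMap F a) (OMap F b) (AMap F a b f) g' = Ide D (OMap F b)"
    using i by (rule isoE)
  obtain g where g: "g \<in> Hom C b a" "AMap F b a g = g'"
    using ff_lift[OF F ab(2,1) g'(1)] .
  have "Comp C a b a g f = Ide C a"
    by (rule ff_inj[OF F ab(1) ab(1)])
      (use ab f g g' C in \<open>simp_all add: functor_Comp[OF Ff] functor_Ide[OF Ff] cat_Comp cat_Ide\<close>)
  moreover have "Comp C b a b f g = Ide C b"
    by (rule ff_inj[OF F ab(2) ab(2)])
      (use ab f g g' C in \<open>simp_all add: functor_Comp[OF Ff] functor_Ide[OF Ff] cat_Comp cat_Ide\<close>)
  ultimately show ?thesis using f g unfolding is_iso_def by blast
qed

text \<open>A test cocone in \<open>B\<close> is carried to \<open>C\<close>, and the mediating morphism found there comes back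
  because \<open>Q\<close> is full.\<close>

lemma ff_reflects_colimit:
  assumes Q: "fully_faithful B C Q" and p: "is_cocone B J D a p"
    and Qp: "is_colimit_cocone C J (comp_functor Q D) (OMap Q a) (\<lambda>j. AMap Q (OMap D j) a (p j))"
  shows "is_colimit_cocone B J D a p"
proof (rule colimit_coconeI[OF p])
  note Qf = ff_functor[OF Q]
  note B = functor_dom[OF Qf]
  note p = coconeD[OF p]
  note D = functor_Ob[OF p(2)]
  { fix b q assume q: "is_cocone B J D b q"
    note b = coconeD(3)[OF q]
    obtain h' where h': "h' \<in> Hom C (OMap Q a) (OMap Q b)"
      "\<And>j. j \<in> Ob J \<Longrightarrow> Comp C (OMap (comp_functor Q D) j) (OMap Q a) (OMap Q b) h'
        (AMap Q (OMap D j) a (p j)) = AMap Q (OMap D j) b (q j)"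
      using colimit_factor[OF Qp functor_cocone[OF Qf q]] by blast
    obtain h where h: "h \<in> Hom B a b" "AMap Q a b h = h'"
      using ff_lift[OF Q p(3) b h'(1)] .
    have "Comp B (OMap D j) a b h (p j) = q j" if j: "j \<in> Ob J" for j
      by (rule ff_inj[OF Q D[OF j] b])
        (use j h h'(2)[OF j] b B p D coconeD(4)[OF q] in \<open>simp_all add: functor_Comp[OF Qf] cat_Comp\<close>)
    then show "\<exists>h\<in>Hom B a b. \<forall>j\<in>Ob J. Comp B (OMap D j) a b h (p j) = q j"
      using h by blast }
  { fix b g h assume b: "b \<in> Ob B" and g: "g \<in> Hom B a b" and h: "h \<in> Hom B a b"
      and eq: "\<And>j. j \<in> Ob J \<Longrightarrow> Comp B (OMap D j) a b g (p j) = Comp B (OMap D j) a b h (p j)"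
    have "AMap Q a b g = AMap Q a b h"
    proof (rule colimit_jointly_epi[OF Qp functor_Ob[OF Qf b]])
      fix j assume j: "j \<in> Ob J"
      show "Comp C (OMap (comp_functor Q D) j) (OMap Q a) (OMap Q b) (AMap Q a b g)
            (AMap Q (OMap D j) a (p j)) =
          Comp C (OMap (comp_functor Q D) j) (OMap Q a) (OMap Q b) (AMap Q a b h)
            (AMap Q (OMap D j) a (p j))"
        using arg_cong[OF eq[OF j], of "AMap Q (OMap D j) b"] j g h b p D
        by (simp add: functor_Comp[OF Qf])
    qed (use functor_Hom[OF Qf] p b g h in auto)
    then show "g = h" using ff_inj[OF Q p(3) b g h] by blast }
qed

text \<open>A test cocone in \<open>D\<close> can be moved along an isomorphism to an apex in the image of \<open>F\<close>, and
  then lies in the image altogether.\<close>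

lemma ff_eso_preserves_colimit:
  assumes F: "fully_faithful C D F" and eso: "essentially_surjective C D F"
    and p: "is_colimit_cocone C J X a p"
  shows "is_colimit_cocone D J (comp_functor F X) (OMap F a) (\<lambda>j. AMap F (OMap X j) a (p j))"
proof (rule colimit_coconeI)
  note Ff = ff_functor[OF F]
  note C = functor_dom[OF Ff] and D = functor_cod[OF Ff]
  note pc = colimit_cocone[OF p]
  note cp = coconeD[OF pc]
  note X = functor_Ob[OF cp(2)]
  note FO = functor_Ob[OF Ff] and FH = functor_Hom[OF Ff]
  show "is_cocone D J (comp_functor F X) (OMap F a) (\<lambda>j. AMap F (OMap X j) a (p j))"
    using functor_cocone[OF Ff pc] .
  { fix b q assume q: "is_cocone D J (comp_functor F X) b q"
    note q = coconeD[OF q]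
    obtain c i where c: "c \<in> Ob C" and i: "is_iso D (OMap F c) b i"
      using eso q(3) unfolding essentially_surjective_def by blast
    obtain i' where ii: "i \<in> Hom D (OMap F c) b" "i' \<in> Hom D b (OMap F c)"
      "Comp D b (OMap F c) b i i' = Ide D b"
      using i by (rule isoE)
    have "\<exists>k\<in>Hom C (OMap X j) c. AMap F (OMap X j) c k = Comp D (OMap F (OMap X j)) b (OMap F c) i' (q j)"
      if j: "j \<in> Ob J" for j
    proof -
      have "Comp D (OMap F (OMap X j)) b (OMap F c) i' (q j) \<in> Hom D (OMap F (OMap X j)) (OMap F c)"
        using q(4)[OF j] by (intro cat_Comp) (simp_all add: D FO X j q(3) c ii)
      then show ?thesis using ff_lift[OF F X[OF j] c] by metis
    qed
    then obtain k where k: "\<And>j. j \<in> Ob J \<Longrightarrow> k j \<in> Hom C (OMap X j) c"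
      "\<And>j. j \<in> Ob J \<Longrightarrow> AMap F (OMap X j) c (k j) = Comp D (OMap F (OMap X j)) b (OMap F c) i' (q j)"
      by metis
    have kc: "is_cocone C J X c k"
      unfolding is_cocone_def
    proof (intro conjI ballI)
      fix j l u assume jl: "j \<in> Ob J" "l \<in> Ob J" "u \<in> Hom J j l"
      note Xu = functor_Hom[OF cp(2) jl]
      show "Comp C (OMap X j) (OMap X l) c (k l) (AMap X j l u) = k j"
      proof (rule ff_inj[OF F X[OF jl(1)] c])
        have "AMap F (OMap X j) c (Comp C (OMap X j) (OMap X l) c (k l) (AMap X j l u)) =
            Comp D (OMap F (OMap X j)) (OMap F (OMap X l)) (OMap F c)
              (Comp D (OMap F (OMap X l)) b (OMap F c) i' (q l)) (AMap F (OMap X j) (OMap X l) (AMap X j l u))"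
          using jl Xu X c k by (simp add: functor_Comp[OF Ff])
        also have "\<dots> = Comp D (OMap F (OMap X j)) b (OMap F c) i'
            (Comp D (OMap F (OMap X j)) (OMap F (OMap X l)) b (q l) (AMap F (OMap X j) (OMap X l) (AMap X j l u)))"
          using jl Xu X c q(3) q(4)[OF jl(2)] D FO FH ii by (simp add: cat_assoc)
        also have "\<dots> = AMap F (OMap X j) c (k j)"
          using q(5)[OF jl] k(2) jl by simp
        finally show "AMap F (OMap X j) c (Comp C (OMap X j) (OMap X l) c (k l) (AMap X j l u)) =
          AMap F (OMap X j) c (k j)" .
      qed (use jl Xu X c k C in \<open>auto intro: cat_Comp\<close>)
    qed (use cp c k in auto)
    obtain h where h: "h \<in> Hom C a c"
      "\<And>j. j \<in> Ob J \<Longrightarrow> Comp C (OMap X j) a c h (p j) = k j"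
      using colimit_factor[OF p kc] by blast
    have "Comp D (OMap F (OMap X j)) (OMap F a) b (Comp D (OMap F a) (OMap F c) b i (AMap F a c h))
        (AMap F (OMap X j) a (p j)) = q j" if j: "j \<in> Ob J" for j
    proof -
      have "Comp D (OMap F (OMap X j)) (OMap F a) b (Comp D (OMap F a) (OMap F c) b i (AMap F a c h))
        (AMap F (OMap X j) a (p j)) = Comp D (OMap F (OMap X j)) (OMap F c) b i (AMap F (OMap X j) c (k j))"
        using j h cp X c q(3) D FO FH ii
        by (simp add: cat_assoc[symmetric] functor_Comp[OF Ff, symmetric])
      also have "\<dots> = q j"
        using j q(3) q(4)[OF j] D FO ii X c by (simp add: k(2) cat_assoc cat_idl)
      finally show ?thesis .
    qed
    then show "\<exists>h\<in>Hom D (OMap F a) b. \<forall>j\<in>Ob J.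
        Comp D (OMap (comp_functor F X) j) (OMap F a) b h (AMap F (OMap X j) a (p j)) = q j"
      using D FO FH cp c q(3) ii h
      by (intro bexI[of _ "Comp D (OMap F a) (OMap F c) b i (AMap F a c h)"]) (auto intro!: cat_Comp) }
  { fix b g h assume b: "b \<in> Ob D" and g: "g \<in> Hom D (OMap F a) b" and h: "h \<in> Hom D (OMap F a) b"
      and eq: "\<And>j. j \<in> Ob J \<Longrightarrow>
        Comp D (OMap (comp_functor F X) j) (OMap F a) b g (AMap F (OMap X j) a (p j)) =
        Comp D (OMap (comp_functor F X) j) (OMap F a) b h (AMap F (OMap X j) a (p j))"
    obtain c i where c: "c \<in> Ob C" and i: "is_iso D (OMap F c) b i"
      using eso b unfolding essentially_surjective_def by blast
    obtain i' where ii: "i' \<in> Hom D b (OMap F c)" "is_iso D b (OMap F c) i'"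
      using i unfolding is_iso_def by blast
    have lift: "\<exists>k\<in>Hom C a c. AMap F a c k = Comp D (OMap F a) b (OMap F c) i' f"
      if "f \<in> Hom D (OMap F a) b" for f
      using ff_lift[OF F cp(3) c, of "Comp D (OMap F a) b (OMap F c) i' f"] that D FO cp(3) b c ii
      by (auto intro: cat_Comp)
    obtain g' h' where gh: "g' \<in> Hom C a c" "AMap F a c g' = Comp D (OMap F a) b (OMap F c) i' g"
      "h' \<in> Hom C a c" "AMap F a c h' = Comp D (OMap F a) b (OMap F c) i' h"
      using lift[OF g] lift[OF h] by blast
    have "g' = h'"
    proof (rule colimit_jointly_epi[OF p c gh(1,3)])
      fix j assume j: "j \<in> Ob J"
      show "Comp C (OMap X j) a c g' (p j) = Comp C (OMap X j) a c h' (p j)"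
        by (rule ff_inj[OF F X[OF j] c])
          (use j gh g h ii c cp X b D C FO FH eq[OF j] in
            \<open>auto simp: functor_Comp[OF Ff] cat_assoc[symmetric] intro!: cat_Comp\<close>)
    qed
    then have "Comp D (OMap F a) b (OMap F c) i' g = Comp D (OMap F a) b (OMap F c) i' h"
      using gh by simp
    then show "g = h"
      using iso_mono[OF D FO[OF cp(3)] b FO[OF c] ii(2) g h] by blast }
qed

text \<open>Both halves of an equivalence are faithful, because one can cancel the isomorphism
  from the composite with the other half; faithfulness of \<open>F\<close> then makes \<open>G\<close> full.\<close>

lemma left_invertible_faithful:
  assumes F: "is_functor C D F" and G: "is_functor D C G"
    and \<alpha>: "naturally_isomorphic C C (comp_functor G F) id_functor"
    and ab: "a \<in> Ob C" "b \<in> Ob C" and f: "f \<in> Hom C a b" and g: "g \<in> Hom C a b"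
    and eq: "AMap F a b f = AMap F a b g"
  shows "f = g"
proof -
  obtain \<alpha> where n: "nat_trans C C (comp_functor G F) id_functor \<alpha>"
    and i: "\<And>a. a \<in> Ob C \<Longrightarrow> is_iso C (OMap G (OMap F a)) a (\<alpha> a)"
    using \<alpha> unfolding naturally_isomorphic_def by auto
  have "Comp C (OMap G (OMap F a)) a b f (\<alpha> a) = Comp C (OMap G (OMap F a)) a b g (\<alpha> a)"
    using n ab f g eq unfolding nat_trans_def by simp metis
  then show ?thesis
    using iso_epi[OF functor_dom[OF F] functor_Ob[OF G functor_Ob[OF F ab(1)]] ab i[OF ab(1)] f g]
    by blast
qed

lemma equivalent_categories_ff_eso:
  assumes "equivalent_categories C D"
  obtains G where "fully_faithful D C G" "essentially_surjective D C G"
proof -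
  obtain F G where F: "is_functor C D F" and G: "is_functor D C G"
    and \<alpha>: "naturally_isomorphic C C (comp_functor G F) id_functor"
    and \<beta>: "naturally_isomorphic D D (comp_functor F G) id_functor"
    using assms unfolding equivalent_categories_def by blast
  note C = functor_dom[OF F] and D = functor_cod[OF F]
  note FO = functor_Ob[OF F] and FH = functor_Hom[OF F]
  note GO = functor_Ob[OF G] and GH = functor_Hom[OF G]
  obtain b where n: "nat_trans D D (comp_functor F G) id_functor b"
    and i: "\<And>d. d \<in> Ob D \<Longrightarrow> is_iso D (OMap F (OMap G d)) d (b d)"
    using \<beta> unfolding naturally_isomorphic_def by auto
  have nat: "Comp D (OMap F (OMap G d)) (OMap F (OMap G d')) d' (b d')
      (AMap F (OMap G d) (OMap G d') (AMap G d d' g)) =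
      Comp D (OMap F (OMap G d)) d d' g (b d)"
    if "d \<in> Ob D" "d' \<in> Ob D" "g \<in> Hom D d d'" for d d' g
    using n that unfolding nat_trans_def by simp
  have "fully_faithful D C G"
  proof (rule fully_faithfulI[OF G])
    fix d d' f g assume "d \<in> Ob D" "d' \<in> Ob D" "f \<in> Hom D d d'" "g \<in> Hom D d d'"
      "AMap G d d' f = AMap G d d' g"
    then show "f = g" using left_invertible_faithful[OF G F \<beta>] by blast
  next
    fix d d' f assume d: "d \<in> Ob D" "d' \<in> Ob D" and f: "f \<in> Hom C (OMap G d) (OMap G d')"
    obtain c where c: "b d \<in> Hom D (OMap F (OMap G d)) d" "c \<in> Hom D d (OMap F (OMap G d))"
      "Comp D (OMap F (OMap G d)) d (OMap F (OMap G d)) c (b d) = Ide D (OMap F (OMap G d))"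
      using i[OF d(1)] by (rule isoE)
    have b': "b d' \<in> Hom D (OMap F (OMap G d')) d'" using i[OF d(2)] by (auto simp: is_iso_def)
    have Ff: "AMap F (OMap G d) (OMap G d') f \<in> Hom D (OMap F (OMap G d)) (OMap F (OMap G d'))"
      using FH d f GO by simp
    \<comment> \<open>Naturality of \<open>b\<close> forces the preimage \<open>g\<close> of \<open>f\<close> to be \<open>b d' \<circ> F f \<circ> inverse (b d)\<close>.\<close>
    define h where "h = Comp D (OMap F (OMap G d)) (OMap F (OMap G d')) d' (b d')
        (AMap F (OMap G d) (OMap G d') f)"
    define g where "g = Comp D d (OMap F (OMap G d)) d' h c"
    have h: "h \<in> Hom D (OMap F (OMap G d)) d'"
      unfolding h_def using D FO GO d b' Ff by (auto intro!: cat_Comp)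
    have g: "g \<in> Hom D d d'"
      unfolding g_def using D FO GO d h c by (auto intro!: cat_Comp)
    have "Comp D (OMap F (OMap G d)) d d' g (b d) = h"
      unfolding g_def using D FO GO d h c
      by (simp add: cat_assoc[symmetric] cat_idr)
    then have "AMap F (OMap G d) (OMap G d') (AMap G d d' g) = AMap F (OMap G d) (OMap G d') f"
      using iso_mono[OF D _ _ d(2) i[OF d(2)] FH[OF GO[OF d(1)] GO[OF d(2)] GH[OF d g]] Ff]
        nat[OF d g] FO GO d unfolding h_def by simp
    then have "AMap G d d' g = f"
      using left_invertible_faithful[OF F G \<alpha> GO[OF d(1)] GO[OF d(2)] GH[OF d g] f] by simp
    then show "\<exists>g\<in>Hom D d d'. AMap G d d' g = f" using g by blast
  qed
  moreover have "essentially_surjective D C G"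
    using \<alpha> FO unfolding essentially_surjective_def naturally_isomorphic_def by auto
  ultimately show thesis using that by blast
qed

section \<open>Universal arrows\<close>

text \<open>A universal arrow from the functor \<open>F\<close> to the object \<open>b\<close>: the pair \<open>(r, e)\<close> represents the
  presheaf \<open>a \<mapsto> Hom D (F a) b\<close>.\<close>

definition universal_arrow ::
  "('o1, 'm1) cat \<Rightarrow> ('o2, 'm2) cat \<Rightarrow> ('o1, 'm1, 'o2, 'm2) fctr \<Rightarrow> 'o2 \<Rightarrow> 'o1 \<Rightarrow> 'm2 \<Rightarrow> bool" where
  "universal_arrow C D F b r e \<longleftrightarrow> r \<in> Ob C \<and> e \<in> Hom D (OMap F r) b \<and>
    (\<forall>a\<in>Ob C. \<forall>h\<in>Hom D (OMap F a) b.
      \<exists>!k. k \<in> Hom C a r \<and> Comp D (OMap F a) (OMap F r) b e (AMap F a r k) = h)"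

lemma universal_arrowI:
  assumes "r \<in> Ob C" "e \<in> Hom D (OMap F r) b"
    and "\<And>a h. a \<in> Ob C \<Longrightarrow> h \<in> Hom D (OMap F a) b \<Longrightarrow>
      \<exists>k\<in>Hom C a r. Comp D (OMap F a) (OMap F r) b e (AMap F a r k) = h"
    and "\<And>a k k'. a \<in> Ob C \<Longrightarrow> k \<in> Hom C a r \<Longrightarrow> k' \<in> Hom C a r \<Longrightarrow>
      Comp D (OMap F a) (OMap F r) b e (AMap F a r k) =
      Comp D (OMap F a) (OMap F r) b e (AMap F a r k') \<Longrightarrow> k = k'"
  shows "universal_arrow C D F b r e"
  unfolding universal_arrow_def
proof (intro conjI ballI)
  fix a h assume "a \<in> Ob C" "h \<in> Hom D (OMap F a) b"
  then show "\<exists>!k. k \<in> Hom C a r \<and> Comp D (OMap F a) (OMap F r) b e (AMap F a r k) = h"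
    using assms(3)[of a h] assms(4)[of a] by blast
qed (use assms in auto)

lemma universal_arrowD:
  assumes "universal_arrow C D F b r e"
  shows "r \<in> Ob C" "e \<in> Hom D (OMap F r) b"
  using assms by (auto simp: universal_arrow_def)

lemma universal_arrow_factor:
  assumes "universal_arrow C D F b r e" "a \<in> Ob C" "h \<in> Hom D (OMap F a) b"
  obtains k where "k \<in> Hom C a r" "Comp D (OMap F a) (OMap F r) b e (AMap F a r k) = h"
  using assms unfolding universal_arrow_def by blast

lemma universal_arrow_unique:
  assumes F: "is_functor C D F" and e: "universal_arrow C D F b r e" and a: "a \<in> Ob C"
    and b: "b \<in> Ob D" and k: "k \<in> Hom C a r" and k': "k' \<in> Hom C a r"
    and eq: "Comp D (OMap F a) (OMap F r) b e (AMap F a r k) =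
      Comp D (OMap F a) (OMap F r) b e (AMap F a r k')"
  shows "k = k'"
proof -
  note e' = universal_arrowD[OF e]
  have "Comp D (OMap F a) (OMap F r) b e (AMap F a r k') \<in> Hom D (OMap F a) b"
    using functor_cod[OF F] functor_Ob[OF F] functor_Hom[OF F] a b k' e' by (auto intro!: cat_Comp)
  then show ?thesis using e a k k' eq unfolding universal_arrow_def by blast
qed

text \<open>The functor is forced on morphisms by naturality of the chosen arrows \<open>e\<close>, and uniqueness of
  factorizations makes it respect composition.\<close>

lemma universal_arrows_functor:
  assumes F: "is_functor C D F" and e: "\<And>b. b \<in> Ob D \<Longrightarrow> universal_arrow C D F b (r b) (e b)"
  obtains G where "is_functor D C G" "OMap G = r"
    "\<And>b b' g. b \<in> Ob D \<Longrightarrow> b' \<in> Ob D \<Longrightarrow> g \<in> Hom D b b' \<Longrightarrow>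
      Comp D (OMap F (r b)) (OMap F (r b')) b' (e b') (AMap F (r b) (r b') (AMap G b b' g)) =
      Comp D (OMap F (r b)) b b' g (e b)"
proof -
  note C = functor_dom[OF F] and D = functor_cod[OF F]
  note FO = functor_Ob[OF F] and FH = functor_Hom[OF F]
  note r = universal_arrowD(1)[OF e] and eH = universal_arrowD(2)[OF e]
  have "\<exists>k\<in>Hom C (r b) (r b'). Comp D (OMap F (r b)) (OMap F (r b')) b' (e b') (AMap F (r b) (r b') k) =
      Comp D (OMap F (r b)) b b' g (e b)" if b: "b \<in> Ob D" "b' \<in> Ob D" "g \<in> Hom D b b'" for b b' g
  proof -
    have "Comp D (OMap F (r b)) b b' g (e b) \<in> Hom D (OMap F (r b)) b'"
      using b D FO r eH by (auto intro!: cat_Comp)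
    then show ?thesis using universal_arrow_factor[OF e[OF b(2)] r[OF b(1)]] by metis
  qed
  then obtain k where k: "\<And>b b' g. b \<in> Ob D \<Longrightarrow> b' \<in> Ob D \<Longrightarrow> g \<in> Hom D b b' \<Longrightarrow> k b b' g \<in> Hom C (r b) (r b')"
    and ek: "\<And>b b' g. b \<in> Ob D \<Longrightarrow> b' \<in> Ob D \<Longrightarrow> g \<in> Hom D b b' \<Longrightarrow>
      Comp D (OMap F (r b)) (OMap F (r b')) b' (e b') (AMap F (r b) (r b') (k b b' g)) =
      Comp D (OMap F (r b)) b b' g (e b)"
    by metis
  define G where "G = \<lparr>OMap = r, AMap = k\<rparr>"
  have G: "OMap G = r" "AMap G = k" by (simp_all add: G_def)
  have "is_functor D C G"
    unfolding is_functor_def G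
  proof (intro conjI ballI C D)
    fix b assume b: "b \<in> Ob D"
    show "k b b (Ide D b) = Ide C (r b)"
      by (rule universal_arrow_unique[OF F e[OF b] r[OF b] b])
        (use b r C D FO eH k in \<open>simp_all add: ek cat_Ide functor_Ide[OF F] cat_idl cat_idr\<close>)
  next
    fix a b c f g assume abc: "a \<in> Ob D" "b \<in> Ob D" "c \<in> Ob D" and f: "f \<in> Hom D a b" and g: "g \<in> Hom D b c"
    note kf = k[OF abc(1,2) f] and kg = k[OF abc(2,3) g]
    have gf: "Comp D a b c g f \<in> Hom D a c" using D abc f g by (auto intro: cat_Comp)
    show "k a c (Comp D a b c g f) = Comp C (r a) (r b) (r c) (k b c g) (k a b f)"
    proof (rule universal_arrow_unique[OF F e[OF abc(3)] r[OF abc(1)] abc(3)])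
      have "Comp D (OMap F (r a)) (OMap F (r c)) c (e c)
          (AMap F (r a) (r c) (Comp C (r a) (r b) (r c) (k b c g) (k a b f))) =
        Comp D (OMap F (r a)) (OMap F (r b)) c
          (Comp D (OMap F (r b)) (OMap F (r c)) c (e c) (AMap F (r b) (r c) (k b c g)))
          (AMap F (r a) (r b) (k a b f))"
        using abc r kf kg D FO FH eH by (simp add: functor_Comp[OF F] cat_assoc)
      also have "\<dots> = Comp D (OMap F (r a)) b c g
          (Comp D (OMap F (r a)) (OMap F (r b)) b (e b) (AMap F (r a) (r b) (k a b f)))"
        using abc r kf kg D FO FH eH g by (simp add: ek cat_assoc)
      also have "\<dots> = Comp D (OMap F (r a)) a c (Comp D a b c g f) (e a)"
        using abc r D FO eH f g by (simp add: ek cat_assoc)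
      finally show "Comp D (OMap F (r a)) (OMap F (r c)) c (e c)
          (AMap F (r a) (r c) (k a c (Comp D a b c g f))) =
        Comp D (OMap F (r a)) (OMap F (r c)) c (e c)
          (AMap F (r a) (r c) (Comp C (r a) (r b) (r c) (k b c g) (k a b f)))"
        using ek[OF abc(1,3) gf] by simp
    qed (use abc r kf kg C k gf in \<open>auto intro: cat_Comp\<close>)
  qed (use r k in auto)
  then show thesis using that G ek by simp
qed

text \<open>A fully faithful and essentially surjective functor \<open>F\<close> is an equivalence: an isomorphism
  from some \<open>F c\<close> to \<open>d\<close> is a universal arrow, so that the chosen preimages form a functor \<open>G\<close>
  and the chosen isomorphisms a natural one.\<close>

lemma ff_eso_equivalent_categories:
  assumes F: "fully_faithful C D F" and eso: "essentially_surjective C D F"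
  shows "equivalent_categories C D"
proof -
  note Ff = ff_functor[OF F]
  note C = functor_dom[OF Ff] and D = functor_cod[OF Ff]
  note FO = functor_Ob[OF Ff] and FH = functor_Hom[OF Ff]
  obtain r e where r: "\<And>d. d \<in> Ob D \<Longrightarrow> r d \<in> Ob C"
    and e: "\<And>d. d \<in> Ob D \<Longrightarrow> is_iso D (OMap F (r d)) d (e d)"
    using eso unfolding essentially_surjective_def by metis
  have u: "universal_arrow C D F d (r d) (e d)" if d: "d \<in> Ob D" for d
  proof (rule universal_arrowI)
    fix a h assume a: "a \<in> Ob C" and h: "h \<in> Hom D (OMap F a) d"
    obtain i where i: "e d \<in> Hom D (OMap F (r d)) d" "i \<in> Hom D d (OMap F (r d))"
      "Comp D d (OMap F (r d)) d (e d) i = Ide D d"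
      using e[OF d] by (rule isoE)
    have "Comp D (OMap F a) d (OMap F (r d)) i h \<in> Hom D (OMap F a) (OMap F (r d))"
      using D FO r d a h i by (auto intro: cat_Comp)
    then obtain k where k: "k \<in> Hom C a (r d)"
      "AMap F a (r d) k = Comp D (OMap F a) d (OMap F (r d)) i h"
      using ff_lift[OF F a r[OF d]] by metis
    then have "Comp D (OMap F a) (OMap F (r d)) d (e d) (AMap F a (r d) k) = h"
      using D FO r d a h i by (simp add: cat_assoc cat_idl)
    then show "\<exists>k\<in>Hom C a (r d). Comp D (OMap F a) (OMap F (r d)) d (e d) (AMap F a (r d) k) = h"
      using k by blast
  next
    fix a k k' assume a: "a \<in> Ob C" and k: "k \<in> Hom C a (r d)" and k': "k' \<in> Hom C a (r d)"
      and eq: "Comp D (OMap F a) (OMap F (r d)) d (e d) (AMap F a (r d) k) =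
        Comp D (OMap F a) (OMap F (r d)) d (e d) (AMap F a (r d) k')"
    have "AMap F a (r d) k = AMap F a (r d) k'"
      using iso_mono[OF D FO[OF a] FO[OF r[OF d]] d e[OF d] _ _ eq] FH a k k' r d by blast
    then show "k = k'" using ff_inj[OF F a r[OF d] k k'] by blast
  qed (use r d e in \<open>auto simp: is_iso_def\<close>)
  from universal_arrows_functor[OF Ff u] obtain G where G: "is_functor D C G" "OMap G = r"
    and nat: "\<And>b b' g. b \<in> Ob D \<Longrightarrow> b' \<in> Ob D \<Longrightarrow> g \<in> Hom D b b' \<Longrightarrow>
      Comp D (OMap F (r b)) (OMap F (r b')) b' (e b') (AMap F (r b) (r b') (AMap G b b' g)) =
      Comp D (OMap F (r b)) b b' g (e b)"
    by blast
  have eH: "\<And>d. d \<in> Ob D \<Longrightarrow> e d \<in> Hom D (OMap F (r d)) d" using e by (auto simp: is_iso_def)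
  have "naturally_isomorphic D D (comp_functor F G) id_functor"
    unfolding naturally_isomorphic_def nat_trans_def using eH e nat G(2) by (intro exI[of _ e]) auto
  moreover have "naturally_isomorphic C C (comp_functor G F) id_functor"
  proof -
    have "\<exists>k\<in>Hom C (r (OMap F c)) c. AMap F (r (OMap F c)) c k = e (OMap F c)" if "c \<in> Ob C" for c
      using ff_lift[OF F r[OF FO[OF that]] that eH[OF FO[OF that]]] by blast
    then obtain k where k: "\<And>c. c \<in> Ob C \<Longrightarrow> k c \<in> Hom C (r (OMap F c)) c"
      and Fk: "\<And>c. c \<in> Ob C \<Longrightarrow> AMap F (r (OMap F c)) c (k c) = e (OMap F c)"
      by metis
    have "nat_trans C C (comp_functor G F) id_functor k"
      unfolding nat_trans_def comp_functor_simps id_functor_simps G(2)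
    proof (intro conjI ballI)
      fix a b f assume ab: "a \<in> Ob C" "b \<in> Ob C" and f: "f \<in> Hom C a b"
      have Gf: "AMap G (OMap F a) (OMap F b) (AMap F a b f) \<in> Hom C (r (OMap F a)) (r (OMap F b))"
        using functor_Hom[OF G(1) FO[OF ab(1)] FO[OF ab(2)] FH[OF ab f]] G(2) by simp
      show "Comp C (r (OMap F a)) (r (OMap F b)) b (k b) (AMap G (OMap F a) (OMap F b) (AMap F a b f)) =
          Comp C (r (OMap F a)) a b f (k a)"
        by (rule ff_inj[OF F r[OF FO[OF ab(1)]] ab(2)])
          (use ab f Gf k r FO FH C D in \<open>simp_all add: functor_Comp[OF Ff] Fk nat cat_Comp\<close>)
    qed (use k in auto)
    moreover have "is_iso C (r (OMap F c)) c (k c)" if "c \<in> Ob C" for c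
      using ff_reflects_iso[OF F r[OF FO[OF that]] that k[OF that]] Fk[OF that] e[OF FO[OF that]]
      by simp
    ultimately show ?thesis
      unfolding naturally_isomorphic_def by (auto simp: G(2))
  qed
  ultimately show ?thesis unfolding equivalent_categories_def using Ff G(1) by blast
qed

text \<open>The counit components of an adjunction are universal arrows, and conversely a choice of
  universal arrows is a right adjoint.\<close>

lemma left_adjoint_universal_arrow:
  assumes "is_left_adjoint C D F" and b: "b \<in> Ob D"
  obtains r e where "universal_arrow C D F b r e"
proof -
  obtain G \<phi> where F: "is_functor C D F" and G: "is_functor D C G"
    and bij': "\<forall>a\<in>Ob C. \<forall>b\<in>Ob D. bij_betw (\<phi> a b) (Hom D (OMap F a) b) (Hom C a (OMap G b))"
    and nat': "\<forall>a\<in>Ob C. \<forall>a'\<in>Ob C. \<forall>b\<in>Ob D. \<forall>f\<in>Hom C a' a. \<forall>h\<in>Hom D (OMap F a) b.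
        \<phi> a' b (Comp D (OMap F a') (OMap F a) b h (AMap F a' a f)) =
        Comp C a' a (OMap G b) (\<phi> a b h) f"
    using assms(1)[unfolded is_left_adjoint_def] by (elim conjE exE) (rule that)
  note bij = bij'[rule_format] and nat = nat'[rule_format]
  note C = functor_dom[OF F] and D = functor_cod[OF F]
  note FO = functor_Ob[OF F] and FH = functor_Hom[OF F]
  have r: "OMap G b \<in> Ob C" using functor_Ob[OF G b] .
  obtain e where e: "e \<in> Hom D (OMap F (OMap G b)) b" "\<phi> (OMap G b) b e = Ide C (OMap G b)"
    using bij[OF r b] cat_Ide[OF C r] unfolding bij_betw_def by (metis imageE)
  have \<phi>: "\<phi> a b (Comp D (OMap F a) (OMap F (OMap G b)) b e (AMap F a (OMap G b) k)) = k"
    if "a \<in> Ob C" "k \<in> Hom C a (OMap G b)" for a k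
    using nat[OF r that(1) b that(2) e(1)] e(2) cat_idl[OF C that(1) r that(2)] by simp
  have "universal_arrow C D F b (OMap G b) e"
  proof (rule universal_arrowI)
    fix a h assume a: "a \<in> Ob C" and h: "h \<in> Hom D (OMap F a) b"
    let ?k = "\<phi> a b h"
    have k: "?k \<in> Hom C a (OMap G b)" using bij[OF a b] h by (auto simp: bij_betw_def)
    have "Comp D (OMap F a) (OMap F (OMap G b)) b e (AMap F a (OMap G b) ?k) \<in> Hom D (OMap F a) b"
      using D FO FH a r b k e by (auto intro!: cat_Comp)
    then have "Comp D (OMap F a) (OMap F (OMap G b)) b e (AMap F a (OMap G b) ?k) = h"
      using bij[OF a b] h \<phi>[OF a k] unfolding bij_betw_def by (meson inj_onD)
    then show "\<exists>k\<in>Hom C a (OMap G b).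
        Comp D (OMap F a) (OMap F (OMap G b)) b e (AMap F a (OMap G b) k) = h"
      using k by blast
  next
    fix a k k' assume "a \<in> Ob C" "k \<in> Hom C a (OMap G b)" "k' \<in> Hom C a (OMap G b)"
      "Comp D (OMap F a) (OMap F (OMap G b)) b e (AMap F a (OMap G b) k) =
       Comp D (OMap F a) (OMap F (OMap G b)) b e (AMap F a (OMap G b) k')"
    then show "k = k'" using \<phi> by metis
  qed (use r e in auto)
  then show thesis using that by blast
qed

lemma universal_arrows_left_adjoint:
  assumes F: "is_functor C D F" and ex: "\<And>b. b \<in> Ob D \<Longrightarrow> \<exists>r e. universal_arrow C D F b r e"
  shows "is_left_adjoint C D F"
proof -
  note C = functor_dom[OF F] and D = functor_cod[OF F]
  note FO = functor_Ob[OF F] and FH = functor_Hom[OF F]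
  obtain r e where u: "\<And>b. b \<in> Ob D \<Longrightarrow> universal_arrow C D F b (r b) (e b)"
    using ex by metis
  note r = universal_arrowD(1)[OF u] and eH = universal_arrowD(2)[OF u]
  from universal_arrows_functor[OF F u] obtain G where G: "is_functor D C G" "OMap G = r"
    and nat: "\<And>b b' g. b \<in> Ob D \<Longrightarrow> b' \<in> Ob D \<Longrightarrow> g \<in> Hom D b b' \<Longrightarrow>
      Comp D (OMap F (r b)) (OMap F (r b')) b' (e b') (AMap F (r b) (r b') (AMap G b b' g)) =
      Comp D (OMap F (r b)) b b' g (e b)"
    by blast
  have "\<exists>k\<in>Hom C a (r b). Comp D (OMap F a) (OMap F (r b)) b (e b) (AMap F a (r b) k) = h"
    if "a \<in> Ob C" "b \<in> Ob D" "h \<in> Hom D (OMap F a) b" for a b h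
    using universal_arrow_factor[OF u that(1,3)] that by blast
  then obtain \<phi> where \<phi>: "\<And>a b h. a \<in> Ob C \<Longrightarrow> b \<in> Ob D \<Longrightarrow> h \<in> Hom D (OMap F a) b \<Longrightarrow> \<phi> a b h \<in> Hom C a (r b)"
    and e\<phi>: "\<And>a b h. a \<in> Ob C \<Longrightarrow> b \<in> Ob D \<Longrightarrow> h \<in> Hom D (OMap F a) b \<Longrightarrow>
      Comp D (OMap F a) (OMap F (r b)) b (e b) (AMap F a (r b) (\<phi> a b h)) = h"
    by metis
  have eqI: "k = \<phi> a b h" if "a \<in> Ob C" "b \<in> Ob D" "k \<in> Hom C a (r b)" "h \<in> Hom D (OMap F a) b"
    "Comp D (OMap F a) (OMap F (r b)) b (e b) (AMap F a (r b) k) = h" for a b h k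
    using universal_arrow_unique[OF F u[OF that(2)] that(1,2,3) \<phi>[OF that(1,2,4)]] e\<phi> that by simp
  have eG: "Comp D (OMap F a) (OMap F (r b)) b (e b) (AMap F a (r b) k) \<in> Hom D (OMap F a) b"
    if "a \<in> Ob C" "b \<in> Ob D" "k \<in> Hom C a (r b)" for a b k
    using that D FO FH r eH by (auto intro!: cat_Comp)
  show ?thesis
    unfolding is_left_adjoint_def
  proof (intro conjI exI[of _ G] exI[of _ \<phi>] ballI F G(1))
    fix a b assume ab: "a \<in> Ob C" "b \<in> Ob D"
    show "bij_betw (\<phi> a b) (Hom D (OMap F a) b) (Hom C a (OMap G b))"
      unfolding G(2)
      by (rule bij_betw_byWitness[where f' = "\<lambda>k. Comp D (OMap F a) (OMap F (r b)) b (e b) (AMap F a (r b) k)"])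
        (use ab \<phi> e\<phi> eqI eG in auto)
  next
    fix a a' b f h assume a: "a \<in> Ob C" "a' \<in> Ob C" and b: "b \<in> Ob D" and f: "f \<in> Hom C a' a"
      and h: "h \<in> Hom D (OMap F a) b"
    show "\<phi> a' b (Comp D (OMap F a') (OMap F a) b h (AMap F a' a f)) =
        Comp C a' a (OMap G b) (\<phi> a b h) f"
      unfolding G(2)
    proof (rule eqI[symmetric])
      show "Comp D (OMap F a') (OMap F (r b)) b (e b) (AMap F a' (r b) (Comp C a' a (r b) (\<phi> a b h) f)) =
          Comp D (OMap F a') (OMap F a) b h (AMap F a' a f)"
        using a b f h \<phi> r eH FO FH D by (simp add: functor_Comp[OF F] cat_assoc e\<phi>)
    qed (use a b f h \<phi> r FO FH C D in \<open>auto intro!: cat_Comp\<close>)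
  next
    fix a b b' g h assume a: "a \<in> Ob C" and b: "b \<in> Ob D" "b' \<in> Ob D" and g: "g \<in> Hom D b b'"
      and h: "h \<in> Hom D (OMap F a) b"
    have Gg: "AMap G b b' g \<in> Hom C (r b) (r b')"
      using functor_Hom[OF G(1) b g] G(2) by simp
    show "\<phi> a b' (Comp D (OMap F a) b b' g h) =
        Comp C a (OMap G b) (OMap G b') (AMap G b b' g) (\<phi> a b h)"
      unfolding G(2)
    proof (rule eqI[symmetric])
      have "Comp D (OMap F a) (OMap F (r b')) b' (e b')
          (AMap F a (r b') (Comp C a (r b) (r b') (AMap G b b' g) (\<phi> a b h))) =
        Comp D (OMap F a) (OMap F (r b)) b' (Comp D (OMap F (r b)) (OMap F (r b')) b' (e b')
          (AMap F (r b) (r b') (AMap G b b' g))) (AMap F a (r b) (\<phi> a b h))"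
        using a b h Gg \<phi> r eH FO FH D by (simp add: functor_Comp[OF F] cat_assoc)
      also have "\<dots> = Comp D (OMap F a) b b' g h"
        using a b g h \<phi> r eH FO FH D by (simp add: nat cat_assoc[symmetric] e\<phi>)
      finally show "Comp D (OMap F a) (OMap F (r b')) b' (e b')
          (AMap F a (r b') (Comp C a (r b) (r b') (AMap G b b' g) (\<phi> a b h))) =
        Comp D (OMap F a) b b' g h" .
    qed (use a b g h Gg \<phi> r FO C D in \<open>auto intro!: cat_Comp\<close>)
  qed
qed

text \<open>Every test object of \<open>A\<close> is isomorphic to some \<open>H m\<close>, so that the universal property only has
  to be known on the image of \<open>H\<close>, and there it is the one in \<open>M\<close>.\<close>

lemma universal_arrow_along_equivalence:
  assumes H: "fully_faithful M A H" and eso: "essentially_surjective M A H" and F: "is_functor A B F"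
    and e: "universal_arrow M B (comp_functor F H) b r e" and b: "b \<in> Ob B"
  shows "universal_arrow A B F b (OMap H r) e"
proof (rule universal_arrowI)
  note Hf = ff_functor[OF H]
  note A = functor_dom[OF F] and B = functor_cod[OF F] and M = functor_dom[OF Hf]
  note FO = functor_Ob[OF F] and FH = functor_Hom[OF F]
  note HO = functor_Ob[OF Hf] and HH = functor_Hom[OF Hf]
  note r = universal_arrowD(1)[OF e]
  have eH: "e \<in> Hom B (OMap F (OMap H r)) b" using universal_arrowD(2)[OF e] by simp
  show "OMap H r \<in> Ob A" "e \<in> Hom B (OMap F (OMap H r)) b" using HO[OF r] eH by auto
  { fix a h assume a: "a \<in> Ob A" and h: "h \<in> Hom B (OMap F a) b"
    obtain m i where m: "m \<in> Ob M" and i: "is_iso A (OMap H m) a i"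
      using eso a unfolding essentially_surjective_def by blast
    obtain i' where ii: "i \<in> Hom A (OMap H m) a" "i' \<in> Hom A a (OMap H m)"
      "Comp A a (OMap H m) a i i' = Ide A a"
      using i by (rule isoE)
    have hi: "Comp B (OMap F (OMap H m)) (OMap F a) b h (AMap F (OMap H m) a i) \<in> Hom B (OMap F (OMap H m)) b"
      using B FO FH HO a b m h ii by (auto intro!: cat_Comp)
    obtain k where k: "k \<in> Hom M m r" and ek: "Comp B (OMap F (OMap H m)) (OMap F (OMap H r)) b e
        (AMap F (OMap H m) (OMap H r) (AMap H m r k)) =
        Comp B (OMap F (OMap H m)) (OMap F a) b h (AMap F (OMap H m) a i)"
      using universal_arrow_factor[OF e m, of "Comp B (OMap F (OMap H m)) (OMap F a) b h (AMap F (OMap H m) a i)"] hi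
      by auto
    \<comment> \<open>Precomposing with \<open>i\<close> moved the problem to \<open>H m\<close>; its inverse moves the solution back.\<close>
    let ?k = "Comp A a (OMap H m) (OMap H r) (AMap H m r k) i'"
    have "Comp B (OMap F a) (OMap F (OMap H r)) b e (AMap F a (OMap H r) ?k) =
        Comp B (OMap F a) (OMap F (OMap H m)) b (Comp B (OMap F (OMap H m)) (OMap F (OMap H r)) b e
        (AMap F (OMap H m) (OMap H r) (AMap H m r k))) (AMap F a (OMap H m) i')"
      using a m r k ii eH b B FO FH HO HH by (simp add: functor_Comp[OF F] cat_assoc)
    also have "\<dots> = Comp B (OMap F a) (OMap F a) b h (AMap F a a (Comp A a (OMap H m) a i i'))"
      unfolding ek using a m ii(1,2) h b B FO FH HO by (simp add: functor_Comp[OF F] cat_assoc)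
    also have "\<dots> = h"
      unfolding ii(3) using a b h B FO by (simp add: functor_Ide[OF F] cat_idr)
    finally show "\<exists>k\<in>Hom A a (OMap H r). Comp B (OMap F a) (OMap F (OMap H r)) b e (AMap F a (OMap H r) k) = h"
      using A a m r k ii HO HH by (intro bexI[of _ ?k]) (auto intro!: cat_Comp) }
  { fix a k k' assume a: "a \<in> Ob A" and k: "k \<in> Hom A a (OMap H r)" and k': "k' \<in> Hom A a (OMap H r)"
      and eq: "Comp B (OMap F a) (OMap F (OMap H r)) b e (AMap F a (OMap H r) k) =
        Comp B (OMap F a) (OMap F (OMap H r)) b e (AMap F a (OMap H r) k')"
    obtain m i where m: "m \<in> Ob M" and i: "is_iso A (OMap H m) a i"
      using eso a unfolding essentially_surjective_def by blast
    then have iH: "i \<in> Hom A (OMap H m) a" by (simp add: is_iso_def)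
    have "\<exists>l\<in>Hom M m r. AMap H m r l = Comp A (OMap H m) a (OMap H r) f i"
      if "f \<in> Hom A a (OMap H r)" for f
      using ff_lift[OF H m r, of "Comp A (OMap H m) a (OMap H r) f i"] that A HO m r a iH
      by (auto intro: cat_Comp)
    then obtain l l' where l: "l \<in> Hom M m r" "AMap H m r l = Comp A (OMap H m) a (OMap H r) k i"
      and l': "l' \<in> Hom M m r" "AMap H m r l' = Comp A (OMap H m) a (OMap H r) k' i"
      using k k' by metis
    have "l = l'"
      by (rule universal_arrow_unique[OF comp_functor_is_functor[OF Hf F] e m b l(1) l'(1)])
        (use l l' a m r k k' iH eH b B FO FH HO eq in \<open>simp add: functor_Comp[OF F] cat_assoc\<close>)
    then have "Comp A (OMap H m) a (OMap H r) k i = Comp A (OMap H m) a (OMap H r) k' i"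
      using l l' by simp
    then show "k = k'" using iso_epi[OF A HO[OF m] a HO[OF r] i k k'] by blast }
qed

section \<open>Sets and hom functors\<close>

lemma SetCat_simps [simp]:
  "Ob SetCat = {X. small X}" "Hom SetCat X Y = X \<rightarrow>\<^sub>E Y" "Comp SetCat X Y Z g f = compose X g f"
  "Ide SetCat X = (\<lambda>x\<in>X. x)"
  by (simp_all add: SetCat_def)

lemma compose_PiE: "f \<in> X \<rightarrow>\<^sub>E Y \<Longrightarrow> g \<in> Y \<rightarrow>\<^sub>E Z \<Longrightarrow> compose X g f \<in> X \<rightarrow>\<^sub>E Z"
  by (auto simp: compose_def)

lemma SetCat_category: "is_category SetCat"
  unfolding is_category_def SetCat_simps
proof (intro conjI ballI)
  fix X Y f assume f: "f \<in> X \<rightarrow>\<^sub>E (Y :: 'a set)"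
  show "compose X f (\<lambda>x\<in>X. x) = f"
    by (rule PiE_ext[OF compose_PiE f]) (use f in \<open>auto simp: compose_def\<close>)
  show "compose X (\<lambda>x\<in>Y. x) f = f"
    by (rule PiE_ext[OF compose_PiE f]) (use f in \<open>auto simp: compose_def\<close>)
next
  fix W X Y Z :: "'a set" and f g h
  assume "f \<in> W \<rightarrow>\<^sub>E X" "g \<in> X \<rightarrow>\<^sub>E Y" "h \<in> Y \<rightarrow>\<^sub>E Z"
  then show "compose W h (compose W g f) = compose W (compose X h g) f"
    by (auto simp: compose_def fun_eq_iff restrict_def)
next
  fix X Y Z :: "'a set" and f g
  assume "f \<in> X \<rightarrow>\<^sub>E Y" "g \<in> Y \<rightarrow>\<^sub>E Z"
  then show "compose X g f \<in> X \<rightarrow>\<^sub>E Z" by (rule compose_PiE)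
qed simp

lemma set_functor_map:
  "is_functor E SetCat M \<Longrightarrow> a \<in> Ob E \<Longrightarrow> b \<in> Ob E \<Longrightarrow> f \<in> Hom E a b
    \<Longrightarrow> AMap M a b f \<in> OMap M a \<rightarrow>\<^sub>E OMap M b"
  using functor_Hom by fastforce

lemma set_functor_app:
  "is_functor E SetCat M \<Longrightarrow> a \<in> Ob E \<Longrightarrow> b \<in> Ob E \<Longrightarrow> f \<in> Hom E a b \<Longrightarrow> x \<in> OMap M a
    \<Longrightarrow> AMap M a b f x \<in> OMap M b"
  using set_functor_map by fastforce

lemma set_functor_Ide:
  "is_functor E SetCat M \<Longrightarrow> a \<in> Ob E \<Longrightarrow> x \<in> OMap M a \<Longrightarrow> AMap M a a (Ide E a) x = x"
  by (simp add: functor_Ide)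

lemma set_functor_Comp:
  "is_functor E SetCat M \<Longrightarrow> a \<in> Ob E \<Longrightarrow> b \<in> Ob E \<Longrightarrow> c \<in> Ob E \<Longrightarrow> f \<in> Hom E a b
    \<Longrightarrow> g \<in> Hom E b c \<Longrightarrow> x \<in> OMap M a
    \<Longrightarrow> AMap M a c (Comp E a b c g f) x = AMap M b c g (AMap M a b f x)"
  by (simp add: functor_Comp compose_def)

definition matching_family :: "('u, 'u) cat \<Rightarrow> ('u, 'u, 'u set, 'u \<Rightarrow> 'u) fctr \<Rightarrow> ('u \<Rightarrow> 'u) \<Rightarrow> bool" where
  "matching_family J D x \<longleftrightarrow> (\<forall>j\<in>Ob J. x j \<in> OMap D j) \<and>
    (\<forall>i\<in>Ob J. \<forall>j\<in>Ob J. \<forall>u\<in>Hom J i j. AMap D i j u (x i) = x j)"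

text \<open>One direction evaluates a cone at each of its points, the other one tests with a one-point
  set.\<close>

lemma set_limit_cone_iff:
  fixes J :: "('u::universe, 'u) cat"
  shows "is_limit_cone SetCat J D X p \<longleftrightarrow> is_cone SetCat J D X p \<and>
    (\<forall>x. matching_family J D x \<longrightarrow> (\<exists>!z. z \<in> X \<and> (\<forall>j\<in>Ob J. p j z = x j)))"
proof (intro iffI conjI allI impI)
  fix x assume lim: "is_limit_cone SetCat J D X p" and x: "matching_family J D x"
  note p = coneD[OF limit_cone[OF lim]]
  define pt :: 'u where "pt = undefined"
  define q where "q = (\<lambda>j. \<lambda>t\<in>{pt}. x j)"
  have "is_cone SetCat J D {pt} q"
    unfolding is_cone_def
    using p(1,2) x by (auto simp: q_def matching_family_def small_finite compose_def intro!: restrict_ext)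
  then obtain h where h: "h \<in> {pt} \<rightarrow>\<^sub>E X" "\<And>j. j \<in> Ob J \<Longrightarrow> compose {pt} (p j) h = q j"
    and un: "\<And>h'. h' \<in> {pt} \<rightarrow>\<^sub>E X \<Longrightarrow> (\<And>j. j \<in> Ob J \<Longrightarrow> compose {pt} (p j) h' = q j) \<Longrightarrow> h' = h"
    using lim unfolding is_limit_cone_def by simp metis
  show "\<exists>!z. z \<in> X \<and> (\<forall>j\<in>Ob J. p j z = x j)"
  proof (rule ex1I[of _ "h pt"])
    have "p j (h pt) = x j" if "j \<in> Ob J" for j
      using fun_cong[OF h(2)[OF that], of pt] by (simp add: q_def compose_def)
    then show "h pt \<in> X \<and> (\<forall>j\<in>Ob J. p j (h pt) = x j)" using h(1) by auto
  next
    fix z assume z: "z \<in> X \<and> (\<forall>j\<in>Ob J. p j z = x j)"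
    have "(\<lambda>t\<in>{pt}. z) = h"
      by (rule un) (use z in \<open>auto simp: q_def compose_def intro!: restrict_ext\<close>)
    then show "z = h pt" by auto
  qed
next
  assume *: "is_cone SetCat J D X p \<and>
    (\<forall>x. matching_family J D x \<longrightarrow> (\<exists>!z. z \<in> X \<and> (\<forall>j\<in>Ob J. p j z = x j)))"
  then have pc: "is_cone SetCat J D X p" by blast
  note p = coneD[OF pc]
  show "is_limit_cone SetCat J D X p"
    unfolding is_limit_cone_def
  proof (intro conjI allI impI pc)
    fix Y q assume "is_cone SetCat J D Y q"
    note q = coneD[OF this]
    have "matching_family J D (\<lambda>j. q j y)" if y: "y \<in> Y" for y
    proof -
      have "AMap D i j u (q i y) = q j y" if "i \<in> Ob J" "j \<in> Ob J" "u \<in> Hom J i j" for i j u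
        using fun_cong[OF q(5)[OF that], of y] y by (simp add: compose_def)
      then show ?thesis using q(4) y unfolding matching_family_def by fastforce
    qed
    then have ex1: "\<exists>!z. z \<in> X \<and> (\<forall>j\<in>Ob J. p j z = q j y)" if "y \<in> Y" for y
      using * that by blast
    then obtain h where h: "\<And>y. y \<in> Y \<Longrightarrow> h y \<in> X \<and> (\<forall>j\<in>Ob J. p j (h y) = q j y)"
      by metis
    show "\<exists>!h. h \<in> Hom SetCat Y X \<and> (\<forall>j\<in>Ob J. Comp SetCat Y X (OMap D j) (p j) h = q j)"
    proof (rule ex1I[of _ "\<lambda>y\<in>Y. h y"])
      have "compose Y (p j) (\<lambda>y\<in>Y. h y) = q j" if j: "j \<in> Ob J" for j
      proof (rule PiE_ext)
        show "compose Y (p j) (\<lambda>y\<in>Y. h y) \<in> Y \<rightarrow>\<^sub>E OMap D j"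
          using h p(4)[OF j] by (intro compose_PiE[of _ _ X]) auto
        show "q j \<in> Y \<rightarrow>\<^sub>E OMap D j" using q(4)[OF j] by simp
      qed (use h j in \<open>auto simp: compose_def\<close>)
      then show "(\<lambda>y\<in>Y. h y) \<in> Hom SetCat Y X \<and>
          (\<forall>j\<in>Ob J. Comp SetCat Y X (OMap D j) (p j) (\<lambda>y\<in>Y. h y) = q j)"
        using h by auto
    next
      fix g assume g: "g \<in> Hom SetCat Y X \<and> (\<forall>j\<in>Ob J. Comp SetCat Y X (OMap D j) (p j) g = q j)"
      show "g = (\<lambda>y\<in>Y. h y)"
      proof (rule PiE_ext[of _ Y "\<lambda>_. X"])
        fix y assume y: "y \<in> Y"
        have "p j (g y) = q j y" if "j \<in> Ob J" for j
        proof -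
          have "compose Y (p j) g = q j" using g that by simp
          from fun_cong[OF this, of y] show ?thesis using y by (simp add: compose_def)
        qed
        moreover have "g y \<in> X" using g y by auto
        ultimately have "g y = h y" using ex1[OF y] h[OF y] by blast
        then show "g y = (\<lambda>y\<in>Y. h y) y" using y by simp
      qed (use g h in auto)
    qed
  qed
qed (auto intro: limit_cone)

lemma hom_functor_simps:
  "OMap (hom_functor C a) b = Hom C a b"
  "AMap (hom_functor C a) b c f = (\<lambda>g\<in>Hom C a b. Comp C a b c f g)"
  by (simp_all add: hom_functor_def)

lemma hom_functor_is_functor:
  assumes C: "is_category C" and small: "locally_small C" and a: "a \<in> Ob C"
  shows "is_functor C SetCat (hom_functor C a)"
  unfolding is_functor_def
proof (intro conjI ballI C SetCat_category)
  fix b assume b: "b \<in> Ob C"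
  show "OMap (hom_functor C a) b \<in> Ob SetCat"
    using small a b by (simp add: locally_small_def hom_functor_simps)
  show "AMap (hom_functor C a) b b (Ide C b) = Ide SetCat (OMap (hom_functor C a) b)"
    using C a b by (auto simp: hom_functor_simps cat_idl)
next
  fix b c f assume "b \<in> Ob C" "c \<in> Ob C" "f \<in> Hom C b c"
  then show "AMap (hom_functor C a) b c f \<in> Hom SetCat (OMap (hom_functor C a) b) (OMap (hom_functor C a) c)"
    using C a by (auto simp: hom_functor_simps intro: cat_Comp)
next
  fix b c d f g assume "b \<in> Ob C" "c \<in> Ob C" "d \<in> Ob C" "f \<in> Hom C b c" "g \<in> Hom C c d"
  then show "AMap (hom_functor C a) b d (Comp C b c d g f) =
      Comp SetCat (OMap (hom_functor C a) b) (OMap (hom_functor C a) c) (OMap (hom_functor C a) d)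
        (AMap (hom_functor C a) c d g) (AMap (hom_functor C a) b c f)"
    using C a by (auto simp: hom_functor_simps compose_def cat_Comp cat_assoc)
qed

lemma functor_cone:
  assumes F: "is_functor C B F" and p: "is_cone C J D a p"
  shows "is_cone B J (comp_functor F D) (OMap F a) (\<lambda>j. AMap F a (OMap D j) (p j))"
  using functor_cocone[OF op_functor_is_functor[OF F], of "op J" "op_functor D" a p] p
  by (simp add: op_cocone flip: op_functor_comp)

text \<open>A matching family in the sets \<open>Hom C a (D j)\<close> is a cone with apex \<open>a\<close>.\<close>

lemma hom_functor_preserves_limit:
  fixes C :: "('o, 'u::universe) cat" and J :: "('u, 'u) cat"
  assumes C: "is_category C" and small: "locally_small C" and a: "a \<in> Ob C"
    and p: "is_limit_cone C J D x p"
  shows "is_limit_cone SetCat J (comp_functor (hom_functor C a) D) (OMap (hom_functor C a) x)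
    (\<lambda>j. AMap (hom_functor C a) x (OMap D j) (p j))"
  unfolding set_limit_cone_iff
proof (intro conjI allI impI)
  note pc = limit_cone[OF p]
  show "is_cone SetCat J (comp_functor (hom_functor C a) D) (OMap (hom_functor C a) x)
    (\<lambda>j. AMap (hom_functor C a) x (OMap D j) (p j))"
    by (rule functor_cone[OF hom_functor_is_functor[OF C small a] pc])
  fix q assume q: "matching_family J (comp_functor (hom_functor C a) D) q"
  have "is_cone C J D a q"
    unfolding is_cone_def
    using q coneD(1,2)[OF pc] a by (auto simp: matching_family_def hom_functor_simps)
  then have "\<exists>!h. h \<in> Hom C a x \<and> (\<forall>j\<in>Ob J. Comp C a x (OMap D j) (p j) h = q j)"
    using p unfolding is_limit_cone_def by blast
  then show "\<exists>!z. z \<in> OMap (hom_functor C a) x \<and>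
      (\<forall>j\<in>Ob J. AMap (hom_functor C a) x (OMap D j) (p j) z = q j)"
    by (simp add: hom_functor_simps conj_ac cong: conj_cong)
qed

section \<open>Models and the Yoneda embedding\<close>

lemma functor_category_simps:
  "Ob (functor_category C D) = {F. is_functor C D F}"
  "Hom (functor_category C D) F G = {\<alpha> \<in> extensional (Ob C). nat_trans C D F G \<alpha>}"
  "Comp (functor_category C D) F G H \<beta> \<alpha> =
    (\<lambda>a\<in>Ob C. Comp D (OMap F a) (OMap G a) (OMap H a) (\<beta> a) (\<alpha> a))"
  "Ide (functor_category C D) F = (\<lambda>a\<in>Ob C. Ide D (OMap F a))"
  by (simp_all add: functor_category_def)

lemma functor_category_category:
  assumes C: "is_category C" and D: "is_category D"
  shows "is_category (functor_category C D)"
proof -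
  have FO: "OMap F a \<in> Ob D" if "is_functor C D F" "a \<in> Ob C" for F a
    using that by (rule functor_Ob)
  have FH: "AMap F a b f \<in> Hom D (OMap F a) (OMap F b)"
    if "is_functor C D F" "a \<in> Ob C" "b \<in> Ob C" "f \<in> Hom C a b" for F a b f
    using that by (rule functor_Hom)
  have nO: "\<alpha> a \<in> Hom D (OMap F a) (OMap G a)" if "nat_trans C D F G \<alpha>" "a \<in> Ob C" for F G \<alpha> a
    using that by (simp add: nat_trans_def)
  show ?thesis
    unfolding is_category_def functor_category_simps
  proof (intro conjI ballI)
    fix F assume F: "F \<in> {F. is_functor C D F}"
    have "nat_trans C D F F (\<lambda>a\<in>Ob C. Ide D (OMap F a))"
      using F FO FH D by (simp add: nat_trans_def cat_Ide cat_idl cat_idr)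
    then show "(\<lambda>a\<in>Ob C. Ide D (OMap F a)) \<in> {\<alpha> \<in> extensional (Ob C). nat_trans C D F F \<alpha>}"
      by simp
  next
    fix F G H \<alpha> \<beta>
    assume *: "F \<in> {F. is_functor C D F}" "G \<in> {F. is_functor C D F}" "H \<in> {F. is_functor C D F}"
      "\<alpha> \<in> {\<alpha> \<in> extensional (Ob C). nat_trans C D F G \<alpha>}"
      "\<beta> \<in> {\<alpha> \<in> extensional (Ob C). nat_trans C D G H \<alpha>}"
    then have F: "is_functor C D F" and G: "is_functor C D G" and H: "is_functor C D H"
      and \<alpha>: "nat_trans C D F G \<alpha>" and \<beta>: "nat_trans C D G H \<beta>"
      by auto
    have "nat_trans C D F H (\<lambda>a\<in>Ob C. Comp D (OMap F a) (OMap G a) (OMap H a) (\<beta> a) (\<alpha> a))"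
      unfolding nat_trans_def
    proof (intro conjI ballI)
      fix a b f assume ab: "a \<in> Ob C" "b \<in> Ob C" and f: "f \<in> Hom C a b"
      note O = FO[OF F ab(1)] FO[OF G ab(1)] FO[OF H ab(1)] FO[OF F ab(2)] FO[OF G ab(2)] FO[OF H ab(2)]
      note h = nO[OF \<alpha> ab(1)] nO[OF \<alpha> ab(2)] nO[OF \<beta> ab(1)] nO[OF \<beta> ab(2)]
        FH[OF F ab f] FH[OF G ab f] FH[OF H ab f]
      have 1: "Comp D (OMap F a) (OMap F b) (OMap G b) (\<alpha> b) (AMap F a b f) =
        Comp D (OMap F a) (OMap G a) (OMap G b) (AMap G a b f) (\<alpha> a)"
        and 2: "Comp D (OMap G a) (OMap G b) (OMap H b) (\<beta> b) (AMap G a b f) =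
        Comp D (OMap G a) (OMap H a) (OMap H b) (AMap H a b f) (\<beta> a)"
        using \<alpha> \<beta> ab f unfolding nat_trans_def by blast+
      have "Comp D (OMap F a) (OMap F b) (OMap H b)
          (Comp D (OMap F b) (OMap G b) (OMap H b) (\<beta> b) (\<alpha> b)) (AMap F a b f) =
        Comp D (OMap F a) (OMap G b) (OMap H b) (\<beta> b)
          (Comp D (OMap F a) (OMap G a) (OMap G b) (AMap G a b f) (\<alpha> a))"
        unfolding 1[symmetric] using D O h by (simp add: cat_assoc)
      also have "\<dots> = Comp D (OMap F a) (OMap G a) (OMap H b)
          (Comp D (OMap G a) (OMap H a) (OMap H b) (AMap H a b f) (\<beta> a)) (\<alpha> a)"
        unfolding 2[symmetric] using D O h by (simp add: cat_assoc)
      also have "\<dots> = Comp D (OMap F a) (OMap H a) (OMap H b) (AMap H a b f)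
          (Comp D (OMap F a) (OMap G a) (OMap H a) (\<beta> a) (\<alpha> a))"
        using D O h by (simp add: cat_assoc)
      finally show "Comp D (OMap F a) (OMap F b) (OMap H b)
          ((\<lambda>a\<in>Ob C. Comp D (OMap F a) (OMap G a) (OMap H a) (\<beta> a) (\<alpha> a)) b) (AMap F a b f) =
        Comp D (OMap F a) (OMap H a) (OMap H b) (AMap H a b f)
          ((\<lambda>a\<in>Ob C. Comp D (OMap F a) (OMap G a) (OMap H a) (\<beta> a) (\<alpha> a)) a)"
        using ab by simp
    qed (use FO[OF F] FO[OF G] FO[OF H] nO[OF \<alpha>] nO[OF \<beta>] D in \<open>auto intro!: cat_Comp\<close>)
    then show "(\<lambda>a\<in>Ob C. Comp D (OMap F a) (OMap G a) (OMap H a) (\<beta> a) (\<alpha> a))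
        \<in> {\<alpha> \<in> extensional (Ob C). nat_trans C D F H \<alpha>}"
      by simp
  next
    fix F G \<alpha>
    assume *: "F \<in> {F. is_functor C D F}" "G \<in> {F. is_functor C D F}"
      "\<alpha> \<in> {\<alpha> \<in> extensional (Ob C). nat_trans C D F G \<alpha>}"
    then have F: "is_functor C D F" and G: "is_functor C D G" and e: "\<alpha> \<in> extensional (Ob C)"
      and \<alpha>: "nat_trans C D F G \<alpha>"
      by auto
    show "(\<lambda>a\<in>Ob C. Comp D (OMap F a) (OMap F a) (OMap G a) (\<alpha> a)
        ((\<lambda>a\<in>Ob C. Ide D (OMap F a)) a)) = \<alpha>"
      by (rule extensionalityI[OF _ e]) (use FO[OF F] FO[OF G] nO[OF \<alpha>] D in \<open>auto simp: cat_idr\<close>)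
    show "(\<lambda>a\<in>Ob C. Comp D (OMap F a) (OMap G a) (OMap G a)
        ((\<lambda>a\<in>Ob C. Ide D (OMap G a)) a) (\<alpha> a)) = \<alpha>"
      by (rule extensionalityI[OF _ e]) (use FO[OF F] FO[OF G] nO[OF \<alpha>] D in \<open>auto simp: cat_idl\<close>)
  next
    fix F G H K \<alpha> \<beta> \<gamma>
    assume *: "F \<in> {F. is_functor C D F}" "G \<in> {F. is_functor C D F}" "H \<in> {F. is_functor C D F}"
      "K \<in> {F. is_functor C D F}" "\<alpha> \<in> {\<alpha> \<in> extensional (Ob C). nat_trans C D F G \<alpha>}"
      "\<beta> \<in> {\<alpha> \<in> extensional (Ob C). nat_trans C D G H \<alpha>}"
      "\<gamma> \<in> {\<alpha> \<in> extensional (Ob C). nat_trans C D H K \<alpha>}"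
    then show "(\<lambda>a\<in>Ob C. Comp D (OMap F a) (OMap H a) (OMap K a) (\<gamma> a)
        ((\<lambda>a\<in>Ob C. Comp D (OMap F a) (OMap G a) (OMap H a) (\<beta> a) (\<alpha> a)) a)) =
      (\<lambda>a\<in>Ob C. Comp D (OMap F a) (OMap G a) (OMap K a)
        ((\<lambda>a\<in>Ob C. Comp D (OMap G a) (OMap H a) (OMap K a) (\<gamma> a) (\<beta> a)) a) (\<alpha> a))"
      using FO nO D by (intro restrict_ext) (simp add: cat_assoc)
  qed
qed

lemma is_model_functor: "is_model E S M \<Longrightarrow> is_functor E SetCat M"
  by (simp add: is_model_def)

lemma Mod_simps:
  "Ob (Mod E S) = {M. is_model E S M}"
  "Hom (Mod E S) M N = {\<alpha> \<in> extensional (Ob E). nat_trans E SetCat M N \<alpha>}"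
  "Comp (Mod E S) M N P \<beta> \<alpha> = (\<lambda>a\<in>Ob E. compose (OMap M a) (\<beta> a) (\<alpha> a))"
  "Ide (Mod E S) M = (\<lambda>a\<in>Ob E. \<lambda>x\<in>OMap M a. x)"
  by (auto simp: Mod_def full_subcategory_def functor_category_simps is_model_functor)

lemma full_subcategory_category: "is_category C \<Longrightarrow> is_category (full_subcategory C P)"
  unfolding is_category_def full_subcategory_def by simp

lemma Mod_category: "is_category E \<Longrightarrow> is_category (Mod E S)"
  unfolding Mod_def
  by (intro full_subcategory_category functor_category_category SetCat_category)

lemma Mod_hom_map:
  "\<alpha> \<in> Hom (Mod E S) M N \<Longrightarrow> a \<in> Ob E \<Longrightarrow> \<alpha> a \<in> OMap M a \<rightarrow>\<^sub>E OMap N a"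
  by (auto simp: Mod_simps nat_trans_def)

lemma Mod_hom_app:
  "\<alpha> \<in> Hom (Mod E S) M N \<Longrightarrow> a \<in> Ob E \<Longrightarrow> x \<in> OMap M a \<Longrightarrow> \<alpha> a x \<in> OMap N a"
  using Mod_hom_map by fastforce

lemma Mod_hom_natural:
  assumes \<alpha>: "\<alpha> \<in> Hom (Mod E S) M N" and ab: "a \<in> Ob E" "b \<in> Ob E" and f: "f \<in> Hom E a b"
    and x: "x \<in> OMap M a"
  shows "\<alpha> b (AMap M a b f x) = AMap N a b f (\<alpha> a x)"
proof -
  have "compose (OMap M a) (\<alpha> b) (AMap M a b f) = compose (OMap M a) (AMap N a b f) (\<alpha> a)"
    using \<alpha> ab f by (simp add: Mod_simps nat_trans_def)
  from fun_cong[OF this, of x] show ?thesis using x by (simp add: compose_def)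
qed

lemma Mod_homI:
  assumes M: "is_functor E SetCat M" and N: "is_functor E SetCat N"
    and app: "\<And>a x. a \<in> Ob E \<Longrightarrow> x \<in> OMap M a \<Longrightarrow> t a x \<in> OMap N a"
    and nat: "\<And>a b f x. a \<in> Ob E \<Longrightarrow> b \<in> Ob E \<Longrightarrow> f \<in> Hom E a b \<Longrightarrow> x \<in> OMap M a
      \<Longrightarrow> t b (AMap M a b f x) = AMap N a b f (t a x)"
  shows "(\<lambda>a\<in>Ob E. \<lambda>x\<in>OMap M a. t a x) \<in> Hom (Mod E S) M N"
proof -
  have "compose (OMap M a) (\<lambda>x\<in>OMap M b. t b x) (AMap M a b f) =
      compose (OMap M a) (AMap N a b f) (\<lambda>x\<in>OMap M a. t a x)"
    if "a \<in> Ob E" "b \<in> Ob E" "f \<in> Hom E a b" for a b f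
    using that nat set_functor_app[OF M] unfolding compose_def by (intro restrict_ext) auto
  then show ?thesis using app by (auto simp: Mod_simps nat_trans_def)
qed

lemma Mod_hom_eqI:
  assumes \<alpha>: "\<alpha> \<in> Hom (Mod E S) M N" and \<beta>: "\<beta> \<in> Hom (Mod E S) M N"
    and eq: "\<And>a x. a \<in> Ob E \<Longrightarrow> x \<in> OMap M a \<Longrightarrow> \<alpha> a x = \<beta> a x"
  shows "\<alpha> = \<beta>"
proof (rule extensionalityI[of _ "Ob E"])
  fix a assume a: "a \<in> Ob E"
  show "\<alpha> a = \<beta> a"
    by (rule PiE_ext[OF Mod_hom_map[OF \<alpha> a] Mod_hom_map[OF \<beta> a]]) (rule eq[OF a])
qed (use \<alpha> \<beta> in \<open>auto simp: Mod_simps\<close>)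

lemma Mod_comp_app:
  "a \<in> Ob E \<Longrightarrow> x \<in> OMap M a \<Longrightarrow> Comp (Mod E S) M N P \<beta> \<alpha> a x = \<beta> a (\<alpha> a x)"
  by (simp add: Mod_simps compose_def)

lemma Mod_bij_iso:
  assumes M: "is_functor E SetCat M" and N: "is_functor E SetCat N"
    and \<alpha>: "\<alpha> \<in> Hom (Mod E S) M N" and bij: "\<And>a. a \<in> Ob E \<Longrightarrow> bij_betw (\<alpha> a) (OMap M a) (OMap N a)"
  shows "is_iso (Mod E S) M N \<alpha>"
proof -
  define \<beta> where "\<beta> = (\<lambda>a\<in>Ob E. \<lambda>x\<in>OMap N a. inv_into (OMap M a) (\<alpha> a) x)"
  have inv: "inv_into (OMap M a) (\<alpha> a) x \<in> OMap M a" "\<alpha> a (inv_into (OMap M a) (\<alpha> a) x) = x"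
    if "a \<in> Ob E" "x \<in> OMap N a" for a x
    using bij[OF that(1)] that(2) by (auto simp: bij_betw_def intro: inv_into_into f_inv_into_f)
  have inv': "inv_into (OMap M a) (\<alpha> a) (\<alpha> a x) = x" if "a \<in> Ob E" "x \<in> OMap M a" for a x
    using bij[OF that(1)] that(2) by (simp add: bij_betw_def)
  have "\<beta> \<in> Hom (Mod E S) N M"
    unfolding \<beta>_def
  proof (rule Mod_homI[OF N M])
    fix a b f x assume ab: "a \<in> Ob E" "b \<in> Ob E" and f: "f \<in> Hom E a b" and x: "x \<in> OMap N a"
    let ?y = "inv_into (OMap M a) (\<alpha> a) x"
    have "AMap N a b f x = \<alpha> b (AMap M a b f ?y)"
      using Mod_hom_natural[OF \<alpha> ab f inv(1)[OF ab(1) x]] inv[OF ab(1) x] by simp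
    then show "inv_into (OMap M b) (\<alpha> b) (AMap N a b f x) = AMap M a b f ?y"
      using inv'[OF ab(2)] set_functor_app[OF M ab f inv(1)[OF ab(1) x]] by simp
  qed (use inv in auto)
  moreover have "Comp (Mod E S) M N M \<beta> \<alpha> = Ide (Mod E S) M"
    using Mod_hom_app[OF \<alpha>] inv' unfolding Mod_simps compose_def \<beta>_def
    by (intro restrict_ext) auto
  moreover have "Comp (Mod E S) N M N \<alpha> \<beta> = Ide (Mod E S) N"
    using inv unfolding Mod_simps compose_def \<beta>_def by (intro restrict_ext) auto
  ultimately show ?thesis using \<alpha> unfolding is_iso_def by blast
qed

text \<open>The morphism out of a representable functor that corresponds to the element \<open>x\<close> of
  \<open>M a\<close> under the Yoneda lemma.\<close>

definition yo :: "('o, 'u) cat \<Rightarrow> ('o, 'u, 'u set, 'u \<Rightarrow> 'u) fctr \<Rightarrow> 'o \<Rightarrow> 'u \<Rightarrow> 'o \<Rightarrow> 'u \<Rightarrow> 'u" where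
  "yo E M a x = (\<lambda>b\<in>Ob E. \<lambda>f\<in>OMap (hom_functor E a) b. AMap M a b f x)"

lemma yo_app: "b \<in> Ob E \<Longrightarrow> f \<in> Hom E a b \<Longrightarrow> yo E M a x b f = AMap M a b f x"
  by (simp add: yo_def hom_functor_simps)

lemma yo_Ide:
  "is_functor E SetCat M \<Longrightarrow> a \<in> Ob E \<Longrightarrow> x \<in> OMap M a \<Longrightarrow> yo E M a x a (Ide E a) = x"
  by (simp add: yo_app set_functor_Ide functor_dom cat_Ide)

lemma yo_hom:
  assumes ls: "locally_small E" and M: "is_functor E SetCat M" and a: "a \<in> Ob E" and x: "x \<in> OMap M a"
  shows "yo E M a x \<in> Hom (Mod E S) (hom_functor E a) M"
  unfolding yo_def
  by (rule Mod_homI[OF hom_functor_is_functor[OF functor_dom[OF M] ls a] M])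
    (use a x set_functor_app[OF M] set_functor_Comp[OF M] in \<open>auto simp: hom_functor_simps\<close>)

lemma yo_unique:
  assumes ls: "locally_small E" and M: "is_functor E SetCat M" and a: "a \<in> Ob E"
    and \<alpha>: "\<alpha> \<in> Hom (Mod E S) (hom_functor E a) M"
  shows "\<alpha> = yo E M a (\<alpha> a (Ide E a))"
proof -
  have E: "is_category E" using M by (rule functor_dom)
  have i: "Ide E a \<in> OMap (hom_functor E a) a" using E a by (simp add: hom_functor_simps cat_Ide)
  show ?thesis
  proof (rule Mod_hom_eqI[OF \<alpha> yo_hom[OF ls M a Mod_hom_app[OF \<alpha> a i]]])
    fix b f assume b: "b \<in> Ob E" and f: "f \<in> OMap (hom_functor E a) b"
    then have f': "f \<in> Hom E a b" by (simp add: hom_functor_simps)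
    have "AMap (hom_functor E a) a b f (Ide E a) = f"
      using E a b f' i by (simp add: hom_functor_simps cat_idr)
    then show "\<alpha> b f = yo E M a (\<alpha> a (Ide E a)) b f"
      using Mod_hom_natural[OF \<alpha> a b f' i] by (simp add: yo_app b f')
  qed
qed

lemma yo_comp:
  assumes ls: "locally_small E" and M: "is_model E S M" and N: "is_model E S N"
    and y: "is_model E S (hom_functor E a)" and a: "a \<in> Ob E"
    and x: "x \<in> OMap M a" and \<alpha>: "\<alpha> \<in> Hom (Mod E S) M N"
  shows "Comp (Mod E S) (hom_functor E a) M N \<alpha> (yo E M a x) = yo E N a (\<alpha> a x)"
proof (rule Mod_hom_eqI)
  note Mf = is_model_functor[OF M] and Nf = is_model_functor[OF N]
  have "is_category (Mod E S)" using functor_dom[OF Mf] by (rule Mod_category)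
  then show "Comp (Mod E S) (hom_functor E a) M N \<alpha> (yo E M a x) \<in> Hom (Mod E S) (hom_functor E a) N"
    by (rule cat_Comp) (use y M N \<alpha> yo_hom[OF ls Mf a x] in \<open>auto simp: Mod_simps(1)\<close>)
  show "yo E N a (\<alpha> a x) \<in> Hom (Mod E S) (hom_functor E a) N"
    using yo_hom[OF ls Nf a Mod_hom_app[OF \<alpha> a x]] .
  fix b f assume "b \<in> Ob E" "f \<in> OMap (hom_functor E a) b"
  then show "Comp (Mod E S) (hom_functor E a) M N \<alpha> (yo E M a x) b f = yo E N a (\<alpha> a x) b f"
    using Mod_hom_natural[OF \<alpha> a] x by (simp add: Mod_comp_app yo_app hom_functor_simps)
qed

definition yoneda :: "('o, 'u) cat \<Rightarrow> ('o, 'u, ('o, 'u, 'u set, 'u \<Rightarrow> 'u) fctr, 'o \<Rightarrow> 'u \<Rightarrow> 'u) fctr" where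
  "yoneda E = \<lparr>OMap = hom_functor E, AMap = (\<lambda>a b f. yo E (hom_functor E b) a f)\<rparr>"

lemma yoneda_simps [simp]:
  "OMap (yoneda E) = hom_functor E" "AMap (yoneda E) a b f = yo E (hom_functor E b) a f"
  by (simp_all add: yoneda_def)

lemma yoneda_ff:
  assumes E: "is_category E" and ls: "locally_small E" and real: "realized E S"
  shows "fully_faithful (op E) (Mod E S) (yoneda E)"
proof (rule fully_faithfulI)
  have y: "is_model E S (hom_functor E a)" if "a \<in> Ob E" for a
    using real that by (simp add: realized_def)
  note yf = is_model_functor[OF y]
  have elem: "f \<in> OMap (hom_functor E b) a" if "f \<in> Hom (op E) a b" for a b f
    using that by (simp add: hom_functor_simps)
  show "is_functor (op E) (Mod E S) (yoneda E)"
    unfolding is_functor_def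
  proof (intro conjI ballI op_category E Mod_category)
    fix a assume a: "a \<in> Ob (op E)"
    show "OMap (yoneda E) a \<in> Ob (Mod E S)" using a y by (simp add: Mod_simps)
    show "AMap (yoneda E) a a (Ide (op E) a) = Ide (Mod E S) (OMap (yoneda E) a)"
      using a E unfolding yo_def Mod_simps
      by (auto simp: yo_def hom_functor_simps cat_Ide cat_idr fun_eq_iff restrict_def)
  next
    fix a b f assume a: "a \<in> Ob (op E)" "b \<in> Ob (op E)" and f: "f \<in> Hom (op E) a b"
    show "AMap (yoneda E) a b f \<in> Hom (Mod E S) (OMap (yoneda E) a) (OMap (yoneda E) b)"
      using yo_hom[OF ls yf _ elem[OF f]] a by simp
  next
    fix a b c f g assume a: "a \<in> Ob (op E)" "b \<in> Ob (op E)" "c \<in> Ob (op E)"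
      and f: "f \<in> Hom (op E) a b" and g: "g \<in> Hom (op E) b c"
    have gH: "yo E (hom_functor E c) b g \<in> Hom (Mod E S) (hom_functor E b) (hom_functor E c)"
      using yo_hom[OF ls yf _ elem[OF g]] a by simp
    show "AMap (yoneda E) a c (Comp (op E) a b c g f) =
        Comp (Mod E S) (OMap (yoneda E) a) (OMap (yoneda E) b) (OMap (yoneda E) c)
          (AMap (yoneda E) b c g) (AMap (yoneda E) a b f)"
      using yo_comp[OF ls y y y _ elem[OF f] gH] a f g
      by (simp add: yo_app hom_functor_simps)
  qed
  fix a b assume a: "a \<in> Ob (op E)" "b \<in> Ob (op E)"
  { fix f g assume "f \<in> Hom (op E) a b" "g \<in> Hom (op E) a b"
      "AMap (yoneda E) a b f = AMap (yoneda E) a b g"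
    then show "f = g" using yo_Ide[OF yf _ elem] a by (metis op_simps(1) yoneda_simps(2)) }
  { fix \<alpha> assume \<alpha>: "\<alpha> \<in> Hom (Mod E S) (OMap (yoneda E) a) (OMap (yoneda E) b)"
    have "\<alpha> a (Ide E a) \<in> Hom (op E) a b"
      using Mod_hom_app[OF \<alpha>, of a "Ide E a"] a E by (simp add: hom_functor_simps cat_Ide)
    then show "\<exists>f\<in>Hom (op E) a b. AMap (yoneda E) a b f = \<alpha>"
      using yo_unique[OF ls yf] \<alpha> a by (metis op_simps(1) yoneda_simps) }
qed

text \<open>For a model \<open>M\<close>, the morphisms \<open>hom_functor E a \<rightarrow> M\<close> are the elements of \<open>M a\<close>, so
  mapping a cone to a limit for all \<open>M\<close> at once is being mapped to a colimit by the Yoneda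
  embedding.\<close>

lemma yoneda_colimit:
  fixes E :: "('o, 'u::universe) cat"
  assumes sk: "limit_sketch E S" and real: "realized E S" and S: "(J, D, a, p) \<in> S"
  shows "is_colimit_cocone (Mod E S) (op J) (comp_functor (yoneda E) (op_functor D)) (hom_functor E a)
    (\<lambda>j. AMap (yoneda E) (OMap D j) a (p j))"
proof -
  have E: "is_category E" and ls: "locally_small E" and p: "is_cone E J D a p"
    using sk S by (auto simp: limit_sketch_def)
  note Y = ff_functor[OF yoneda_ff[OF E ls real]]
  note cp = coneD[OF p]
  note D = functor_Ob[OF cp(2)]
  have y: "is_model E S (hom_functor E b)" if "b \<in> Ob E" for b
    using real that by (simp add: realized_def)
  have pe: "p j \<in> OMap (hom_functor E a) (OMap D j)" if "j \<in> Ob J" for j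
    using cp(4)[OF that] by (simp add: hom_functor_simps)
  show ?thesis
  proof (rule colimit_coconeI)
    show "is_cocone (Mod E S) (op J) (comp_functor (yoneda E) (op_functor D)) (hom_functor E a)
      (\<lambda>j. AMap (yoneda E) (OMap D j) a (p j))"
      using functor_cocone[OF Y, of "op J" "op_functor D" a p] p by (simp add: op_cocone)
    fix M
    { fix q assume "is_cocone (Mod E S) (op J) (comp_functor (yoneda E) (op_functor D)) M q"
      note q = coconeD[OF this]
      have M: "is_model E S M" using q(3) by (simp add: Mod_simps)
      note Mf = is_model_functor[OF M]
      have qH: "q j \<in> Hom (Mod E S) (hom_functor E (OMap D j)) M" if "j \<in> Ob J" for j
        using q(4) that by simp
      \<comment> \<open>The element of \<open>M (D j)\<close> that corresponds to the leg \<open>q j\<close>.\<close>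
      define x where "x j = q j (OMap D j) (Ide E (OMap D j))" for j
      have x: "x j \<in> OMap M (OMap D j)" if "j \<in> Ob J" for j
        unfolding x_def
        by (rule Mod_hom_app[OF qH[OF that] D[OF that]])
          (simp add: hom_functor_simps cat_Ide[OF E D[OF that]])
      have qx: "q j = yo E M (OMap D j) (x j)" if "j \<in> Ob J" for j
        unfolding x_def by (rule yo_unique[OF ls Mf D[OF that] qH[OF that]])
      have "AMap M (OMap D i) (OMap D j) (AMap D i j u) (x i) = x j"
        if ij: "i \<in> Ob J" "j \<in> Ob J" "u \<in> Hom J i j" for i j u
      proof -
        note u = functor_Hom[OF cp(2) ij]
        have "q j = Comp (Mod E S) (hom_functor E (OMap D j)) (hom_functor E (OMap D i)) M (q i)
            (yo E (hom_functor E (OMap D i)) (OMap D j) (AMap D i j u))"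
          using q(5)[of j i u] ij by simp
        also have "\<dots> = yo E M (OMap D j) (q i (OMap D j) (AMap D i j u))"
          by (rule yo_comp[OF ls y M y D _ qH])
            (use ij u D in \<open>auto simp: hom_functor_simps\<close>)
        also have "q i (OMap D j) (AMap D i j u) = AMap M (OMap D i) (OMap D j) (AMap D i j u) (x i)"
          using qx ij u D by (simp add: yo_app)
        finally have "x j = yo E M (OMap D j) (AMap M (OMap D i) (OMap D j) (AMap D i j u) (x i))
            (OMap D j) (Ide E (OMap D j))"
          by (simp only: x_def[of j])
        also have "\<dots> = AMap M (OMap D i) (OMap D j) (AMap D i j u) (x i)"
          using ij u D x by (intro yo_Ide[OF Mf] set_functor_app[OF Mf])
        finally show ?thesis ..
      qed
      then have "matching_family J (comp_functor M D) x"
        using x by (simp add: matching_family_def)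
      moreover have "is_limit_cone SetCat J (comp_functor M D) (OMap M a) (\<lambda>j. AMap M a (OMap D j) (p j))"
        using M S by (auto simp: is_model_def)
      ultimately obtain z where z: "z \<in> OMap M a" "\<And>j. j \<in> Ob J \<Longrightarrow> AMap M a (OMap D j) (p j) z = x j"
        unfolding set_limit_cone_iff by blast
      have "Comp (Mod E S) (hom_functor E (OMap D j)) (hom_functor E a) M (yo E M a z)
          (yo E (hom_functor E a) (OMap D j) (p j)) = q j" if j: "j \<in> Ob J" for j
        using yo_comp[OF ls y[OF cp(3)] M y[OF D[OF j]] D[OF j] pe[OF j] yo_hom[OF ls Mf cp(3) z(1)]]
          z(2)[OF j] qx[OF j] cp(4)[OF j] D[OF j]
        by (simp add: yo_app)
      then show "\<exists>h\<in>Hom (Mod E S) (hom_functor E a) M. \<forall>j\<in>Ob (op J).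
          Comp (Mod E S) (OMap (comp_functor (yoneda E) (op_functor D)) j) (hom_functor E a) M h
            (AMap (yoneda E) (OMap D j) a (p j)) = q j"
        using yo_hom[OF ls Mf cp(3) z(1)] by auto }
    { fix g h assume M: "M \<in> Ob (Mod E S)"
        and g: "g \<in> Hom (Mod E S) (hom_functor E a) M" and h: "h \<in> Hom (Mod E S) (hom_functor E a) M"
        and eq: "\<And>j. j \<in> Ob (op J) \<Longrightarrow>
          Comp (Mod E S) (OMap (comp_functor (yoneda E) (op_functor D)) j) (hom_functor E a) M g
            (AMap (yoneda E) (OMap D j) a (p j)) =
          Comp (Mod E S) (OMap (comp_functor (yoneda E) (op_functor D)) j) (hom_functor E a) M h
            (AMap (yoneda E) (OMap D j) a (p j))"
      have M: "is_model E S M" using M by (simp add: Mod_simps)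
      note Mf = is_model_functor[OF M]
      have i: "Ide E a \<in> OMap (hom_functor E a) a" by (simp add: hom_functor_simps cat_Ide[OF E cp(3)])
      define x z where "x = g a (Ide E a)" and "z = h a (Ide E a)"
      have xz: "x \<in> OMap M a" "z \<in> OMap M a"
        unfolding x_def z_def using Mod_hom_app[OF g cp(3) i] Mod_hom_app[OF h cp(3) i] by auto
      have gx: "g = yo E M a x" and hz: "h = yo E M a z"
        unfolding x_def z_def by (rule yo_unique[OF ls Mf cp(3) g] yo_unique[OF ls Mf cp(3) h])+
      have pxz: "AMap M a (OMap D j) (p j) x = AMap M a (OMap D j) (p j) z" if j: "j \<in> Ob J" for j
      proof -
        have "yo E M (OMap D j) (AMap M a (OMap D j) (p j) x) = yo E M (OMap D j) (AMap M a (OMap D j) (p j) z)"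
          using eq[of j] j yo_comp[OF ls y[OF cp(3)] M y[OF D[OF j]] D[OF j] pe[OF j] g]
            yo_comp[OF ls y[OF cp(3)] M y[OF D[OF j]] D[OF j] pe[OF j] h] cp(4)[OF j] D[OF j]
          by (simp add: gx hz yo_app)
        then show ?thesis
          using yo_Ide[OF Mf D[OF j]] set_functor_app[OF Mf cp(3) D[OF j] cp(4)[OF j]] xz by metis
      qed
      have lim: "is_limit_cone SetCat J (comp_functor M D) (OMap M a) (\<lambda>j. AMap M a (OMap D j) (p j))"
        using M S by (auto simp: is_model_def)
      have "AMap M (OMap D i) (OMap D j) (AMap D i j u) (AMap M a (OMap D i) (p i) z) =
          AMap M a (OMap D j) (p j) z" if ij: "i \<in> Ob J" "j \<in> Ob J" "u \<in> Hom J i j" for i j u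
        using set_functor_Comp[OF Mf cp(3) D[OF ij(1)] D[OF ij(2)] cp(4)[OF ij(1)]
            functor_Hom[OF cp(2) ij] xz(2)] cp(5)[OF ij] by simp
      then have "matching_family J (comp_functor M D) (\<lambda>j. AMap M a (OMap D j) (p j) z)"
        using set_functor_app[OF Mf cp(3) D cp(4) xz(2)] by (simp add: matching_family_def)
      then have "\<exists>!w. w \<in> OMap M a \<and> (\<forall>j\<in>Ob J. AMap M a (OMap D j) (p j) w = AMap M a (OMap D j) (p j) z)"
        using lim unfolding set_limit_cone_iff by blast
      then have "x = z" using xz pxz by blast
      then show "g = h" using gx hz by simp }
  qed
qed

section \<open>Categories of models of realized sketches\<close>

lemma cocontinuous_functor: "cocontinuous C B F \<Longrightarrow> is_functor C B F"
  by (simp add: cocontinuous_def)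

lemma cocontinuous_colimit:
  fixes B :: "('o, 'u) cat" and J :: "('u, 'u) cat"
  shows "cocontinuous C B F \<Longrightarrow> is_colimit_cocone C J D a p
    \<Longrightarrow> is_colimit_cocone B J (comp_functor F D) (OMap F a) (\<lambda>j. AMap F (OMap D j) a (p j))"
  by (simp add: cocontinuous_def)

lemma cocontinuous_comp_ff_eso:
  assumes F: "cocontinuous A B F" and H: "fully_faithful M A H" and eso: "essentially_surjective M A H"
  shows "cocontinuous M B (comp_functor F H)"
  unfolding cocontinuous_def
  using comp_functor_is_functor[OF ff_functor[OF H] cocontinuous_functor[OF F]]
    cocontinuous_colimit[OF F ff_eso_preserves_colimit[OF H eso]]
  by (simp add: comp_functor_assoc)

text \<open>With \<open>y\<close> the Yoneda embedding, the model \<open>N e = Hom B (F (y e)) b\<close> represents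
  \<open>M \<mapsto> Hom B (F M) b\<close>: a morphism \<open>h : F M \<rightarrow> b\<close> corresponds to the transformation \<open>hat M h\<close>
  that sends \<open>x \<in> M e\<close>, seen as \<open>y e \<rightarrow> M\<close>, to its image under \<open>F\<close> followed by \<open>h\<close>.
  For representable \<open>M\<close> this is the Yoneda lemma, and both sides turn a colimit of
  representables into a limit.\<close>

lemma Mod_universal_arrow:
  fixes E :: "('o, 'u::universe) cat" and B :: "('p, 'u) cat"
  assumes sk: "limit_sketch E S" and real: "realized E S"
    and small: "\<And>M. is_model E S M \<Longrightarrow> small_model E S M"
    and F: "cocontinuous (Mod E S) B F" and lsB: "locally_small B" and b: "b \<in> Ob B"
  shows "\<exists>r e. universal_arrow (Mod E S) B F b r e"
proof -
  have E: "is_category E" and ls: "locally_small E"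
    using sk by (auto simp: limit_sketch_def)
  let ?M = "Mod E S"
  note Ff = cocontinuous_functor[OF F]
  note Y = ff_functor[OF yoneda_ff[OF E ls real]]
  note M = functor_dom[OF Ff] and B = functor_cod[OF Ff]
  have y: "is_model E S (hom_functor E a)" if "a \<in> Ob E" for a
    using real that by (simp add: realized_def)
  note FO = functor_Ob[OF Ff, unfolded Mod_simps(1), OF CollectI]
  note FH = functor_Hom[OF Ff, unfolded Mod_simps(1), OF CollectI CollectI]
  note FC = functor_Comp[OF Ff, unfolded Mod_simps(1), OF CollectI CollectI CollectI]
  define N where "N = comp_functor (hom_functor (op B) b) (op_functor (comp_functor F (yoneda E)))"
  have N_Ob: "OMap N a = Hom B (OMap F (hom_functor E a)) b" for a
    by (simp add: N_def hom_functor_simps)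
  have N_map: "AMap N a c f g = Comp B (OMap F (hom_functor E c)) (OMap F (hom_functor E a)) b g
      (AMap F (hom_functor E c) (hom_functor E a) (yo E (hom_functor E a) c f))"
    if "g \<in> Hom B (OMap F (hom_functor E a)) b" for a c f g
    using that by (simp add: N_def hom_functor_simps)
  have Nf: "is_functor E SetCat N"
    unfolding N_def
    using op_functor_is_functor[OF comp_functor_is_functor[OF Y Ff]]
      hom_functor_is_functor[OF op_category[OF B] op_locally_small[OF lsB]] b
    by (auto intro: comp_functor_is_functor)
  \<comment> \<open>Distinguished cones become colimit cocones under \<open>y\<close> and \<open>F\<close>, and limit cones under
    \<open>Hom B (-) b\<close>.\<close>
  have N: "is_model E S N"
    unfolding is_model_def
  proof (intro conjI Nf ballI, clarify)
    fix J D a p assume S: "(J, D, a, p) \<in> S"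
    have "is_colimit_cocone B (op J) (comp_functor F (comp_functor (yoneda E) (op_functor D)))
        (OMap F (hom_functor E a))
        (\<lambda>j. AMap F (hom_functor E (OMap D j)) (hom_functor E a) (yo E (hom_functor E a) (OMap D j) (p j)))"
      using cocontinuous_colimit[OF F yoneda_colimit[OF sk real S]] by simp
    then have "is_limit_cone (op B) J (comp_functor (op_functor (comp_functor F (yoneda E))) D)
        (OMap F (hom_functor E a))
        (\<lambda>j. AMap F (hom_functor E (OMap D j)) (hom_functor E a) (yo E (hom_functor E a) (OMap D j) (p j)))"
      by (simp add: op_functor_comp comp_functor_assoc flip: op_limit_cone)
    from hom_functor_preserves_limit[OF op_category[OF B] op_locally_small[OF lsB] _ this, of b] b
    show "is_limit_cone SetCat J (comp_functor N D) (OMap N a) (\<lambda>j. AMap N a (OMap D j) (p j))"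
      by (simp add: N_def comp_functor_assoc)
  qed
  define hat where "hat M h = (\<lambda>a\<in>Ob E. \<lambda>x\<in>OMap M a.
      Comp B (OMap F (hom_functor E a)) (OMap F M) b h (AMap F (hom_functor E a) M (yo E M a x)))" for M h
  have hat_app: "hat M h a x =
      Comp B (OMap F (hom_functor E a)) (OMap F M) b h (AMap F (hom_functor E a) M (yo E M a x))"
    if "a \<in> Ob E" "x \<in> OMap M a" for M h a x
    using that by (simp add: hat_def)
  have hat: "hat M h \<in> Hom ?M M N" if M: "is_model E S M" and h: "h \<in> Hom B (OMap F M) b" for M h
    unfolding hat_def
  proof (rule Mod_homI[OF is_model_functor[OF M] Nf])
    note Mf = is_model_functor[OF M]
    fix a x assume a: "a \<in> Ob E" and x: "x \<in> OMap M a"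
    have Fx: "AMap F (hom_functor E a) M (yo E M a x) \<in> Hom B (OMap F (hom_functor E a)) (OMap F M)"
      using FH[OF y[OF a] M yo_hom[OF ls Mf a x]] .
    show hFx: "Comp B (OMap F (hom_functor E a)) (OMap F M) b h (AMap F (hom_functor E a) M (yo E M a x))
        \<in> OMap N a"
      unfolding N_Ob using B FO[OF y[OF a]] FO[OF M] b Fx h by (rule cat_Comp)
    fix c f assume c: "c \<in> Ob E" and f: "f \<in> Hom E a c"
    have fe: "f \<in> OMap (hom_functor E a) c" using f by (simp add: hom_functor_simps)
    have "Comp ?M (hom_functor E c) (hom_functor E a) M (yo E M a x) (yo E (hom_functor E a) c f) =
        yo E M c (AMap M a c f x)"
      using yo_comp[OF ls y[OF a] M y[OF c] c fe yo_hom[OF ls Mf a x]] yo_app[OF c f] by simp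
    then have "AMap F (hom_functor E c) M (yo E M c (AMap M a c f x)) =
        Comp B (OMap F (hom_functor E c)) (OMap F (hom_functor E a)) (OMap F M)
          (AMap F (hom_functor E a) M (yo E M a x))
          (AMap F (hom_functor E c) (hom_functor E a) (yo E (hom_functor E a) c f))"
      using FC[OF y[OF c] y[OF a] M yo_hom[OF ls is_model_functor[OF y[OF a]] c fe] yo_hom[OF ls Mf a x]]
      by simp
    then show "Comp B (OMap F (hom_functor E c)) (OMap F M) b h
          (AMap F (hom_functor E c) M (yo E M c (AMap M a c f x))) =
        AMap N a c f (Comp B (OMap F (hom_functor E a)) (OMap F M) b h
          (AMap F (hom_functor E a) M (yo E M a x)))"
      using N_map[OF hFx[unfolded N_Ob]] Fx h b B FO y a c M
        FH[OF y[OF c] y[OF a] yo_hom[OF ls is_model_functor[OF y[OF a]] c fe]]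
      by (simp add: cat_assoc)
  qed
  have hat_natural: "hat M (Comp B (OMap F M) (OMap F P) b h (AMap F M P k)) = Comp ?M M P N (hat P h) k"
    if M: "is_model E S M" and P: "is_model E S P" and h: "h \<in> Hom B (OMap F P) b"
      and k: "k \<in> Hom ?M M P" for M P h k
  proof (rule Mod_hom_eqI)
    note Mf = is_model_functor[OF M]
    note Fk = FH[OF M P k]
    show "hat M (Comp B (OMap F M) (OMap F P) b h (AMap F M P k)) \<in> Hom ?M M N"
      using hat[OF M cat_Comp[OF B FO[OF M] FO[OF P] b Fk h]] .
    show "Comp ?M M P N (hat P h) k \<in> Hom ?M M N"
      using \<open>is_category ?M\<close> _ _ _ k hat[OF P h]
      by (rule cat_Comp) (use M P N in \<open>auto simp: Mod_simps(1)\<close>)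
    fix a x assume a: "a \<in> Ob E" and x: "x \<in> OMap M a"
    have "AMap F (hom_functor E a) P (yo E P a (k a x)) =
        Comp B (OMap F (hom_functor E a)) (OMap F M) (OMap F P) (AMap F M P k)
          (AMap F (hom_functor E a) M (yo E M a x))"
      using FC[OF y[OF a] M P yo_hom[OF ls Mf a x] k] yo_comp[OF ls M P y[OF a] a x k] by simp
    then show "hat M (Comp B (OMap F M) (OMap F P) b h (AMap F M P k)) a x = Comp ?M M P N (hat P h) k a x"
      using a x Mod_hom_app[OF k a x] FH[OF y[OF a] M yo_hom[OF ls Mf a x]] Fk h b B FO y M P
      by (simp add: hat_app Mod_comp_app cat_assoc)
  qed
  have colim: "\<exists>(J :: ('u, 'u) cat) D p. is_colimit_cocone ?M J D M p \<and> (\<forall>j\<in>Ob J. \<exists>a\<in>Ob E. \<exists>x\<in>OMap M a.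
      OMap D j = hom_functor E a \<and> p j = yo E M a x)" if M: "is_model E S M" for M
  proof -
    obtain J :: "('u, 'u) cat" and D p where p: "is_colimit_cocone ?M J D M p"
      and D: "\<And>j. j \<in> Ob J \<Longrightarrow> \<exists>a\<in>Ob E. OMap D j = hom_functor E a"
      using small[OF M] unfolding small_model_def by blast
    have "\<exists>a\<in>Ob E. \<exists>x\<in>OMap M a. OMap D j = hom_functor E a \<and> p j = yo E M a x" if j: "j \<in> Ob J" for j
    proof -
      obtain a where a: "a \<in> Ob E" "OMap D j = hom_functor E a" using D[OF j] by blast
      have pj: "p j \<in> Hom ?M (hom_functor E a) M"
        using coconeD(4)[OF colimit_cocone[OF p] j] a by simp
      have "p j a (Ide E a) \<in> OMap M a"
        by (rule Mod_hom_app[OF pj a(1)]) (simp add: hom_functor_simps cat_Ide[OF E a(1)])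
      then show ?thesis using a yo_unique[OF ls is_model_functor[OF M] a(1) pj] by blast
    qed
    then show ?thesis using p by blast
  qed
  \<comment> \<open>On the legs of the colimit, \<open>hat M h\<close> records the composites of \<open>h\<close> with the images of the legs
    under \<open>F\<close>, which again form a colimit cocone.\<close>
  have hat_inj: "g = h" if M: "is_model E S M" and g: "g \<in> Hom B (OMap F M) b"
    and h: "h \<in> Hom B (OMap F M) b" and eq: "hat M g = hat M h" for M g h
  proof -
    obtain J :: "('u, 'u) cat" and D p where p: "is_colimit_cocone ?M J D M p"
      and D: "\<forall>j\<in>Ob J. \<exists>a\<in>Ob E. \<exists>x\<in>OMap M a. OMap D j = hom_functor E a \<and> p j = yo E M a x"
      using colim[OF M] by blast
    show ?thesis
    proof (rule colimit_jointly_epi[OF cocontinuous_colimit[OF F p] b g h])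
      fix j assume "j \<in> Ob J"
      then obtain a x where a: "a \<in> Ob E" "x \<in> OMap M a" "OMap D j = hom_functor E a" "p j = yo E M a x"
        using D by blast
      show "Comp B (OMap (comp_functor F D) j) (OMap F M) b g (AMap F (OMap D j) M (p j)) =
          Comp B (OMap (comp_functor F D) j) (OMap F M) b h (AMap F (OMap D j) M (p j))"
        using hat_app[OF a(1,2), of g] hat_app[OF a(1,2), of h] eq a(3,4) by simp
    qed
  qed
  have hat_surj: "\<exists>h\<in>Hom B (OMap F M) b. hat M h = \<alpha>"
    if M: "is_model E S M" and \<alpha>: "\<alpha> \<in> Hom ?M M N" for M \<alpha>
  proof -
    note Mf = is_model_functor[OF M]
    obtain J :: "('u, 'u) cat" and D p where p: "is_colimit_cocone ?M J D M p"
      and "\<forall>j\<in>Ob J. \<exists>a\<in>Ob E. \<exists>x\<in>OMap M a. OMap D j = hom_functor E a \<and> p j = yo E M a x"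
      using colim[OF M] by blast
    then obtain a x where a: "\<And>j. j \<in> Ob J \<Longrightarrow> a j \<in> Ob E" and x: "\<And>j. j \<in> Ob J \<Longrightarrow> x j \<in> OMap M (a j)"
      and D: "\<And>j. j \<in> Ob J \<Longrightarrow> OMap D j = hom_functor E (a j)"
      and px: "\<And>j. j \<in> Ob J \<Longrightarrow> p j = yo E M (a j) (x j)"
      by metis
    note cp = coconeD[OF colimit_cocone[OF p]]
    define q where "q j = \<alpha> (a j) (x j)" for j
    have q: "q j \<in> Hom B (OMap F (hom_functor E (a j))) b" if "j \<in> Ob J" for j
      using Mod_hom_app[OF \<alpha> a[OF that] x[OF that]] by (simp add: q_def N_Ob)
    have "is_cocone B J (comp_functor F D) b q"
      unfolding is_cocone_def
    proof (intro conjI ballI)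
      fix i j u assume ij: "i \<in> Ob J" "j \<in> Ob J" and u: "u \<in> Hom J i j"
      note ai = a[OF ij(1)] and aj = a[OF ij(2)] and xj = x[OF ij(2)]
      \<comment> \<open>The diagram morphism between representables is itself of the form \<open>y v\<close>.\<close>
      let ?v = "AMap D i j u (a i) (Ide E (a i))"
      have Du: "AMap D i j u \<in> Hom ?M (hom_functor E (a i)) (hom_functor E (a j))"
        using functor_Hom[OF cp(2) ij u] D ij by simp
      have v: "?v \<in> OMap (hom_functor E (a j)) (a i)"
        by (rule Mod_hom_app[OF Du ai]) (simp add: hom_functor_simps cat_Ide[OF E ai])
      then have vH: "?v \<in> Hom E (a j) (a i)" by (simp add: hom_functor_simps)
      have Duv: "AMap D i j u = yo E (hom_functor E (a j)) (a i) ?v"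
        using yo_unique[OF ls is_model_functor[OF y[OF aj]] ai Du] .
      have "yo E M (a i) (x i) = Comp ?M (hom_functor E (a i)) (hom_functor E (a j)) M (yo E M (a j) (x j))
          (yo E (hom_functor E (a j)) (a i) ?v)"
        using cp(5)[OF ij u] D ij px Duv by simp
      also have "\<dots> = yo E M (a i) (AMap M (a j) (a i) ?v (x j))"
        using yo_comp[OF ls y[OF aj] M y[OF ai] ai v yo_hom[OF ls Mf aj xj]] yo_app[OF ai vH] by simp
      finally have "x i = AMap M (a j) (a i) ?v (x j)"
        using yo_Ide[OF Mf ai x[OF ij(1)]] yo_Ide[OF Mf ai set_functor_app[OF Mf aj ai vH xj]] by metis
      then have "q i = AMap N (a j) (a i) ?v (q j)"
        using Mod_hom_natural[OF \<alpha> aj ai vH xj] by (simp only: q_def)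
      then show "Comp B (OMap (comp_functor F D) i) (OMap (comp_functor F D) j) b (q j)
          (AMap (comp_functor F D) i j u) = q i"
        using N_map[OF q[OF ij(2)]] Duv D ij by simp
    qed (use cp comp_functor_is_functor[OF cp(2) Ff] b q D in auto)
    from colimit_factor[OF cocontinuous_colimit[OF F p] this]
    obtain h where h: "h \<in> Hom B (OMap F M) b"
      "\<And>j. j \<in> Ob J \<Longrightarrow> Comp B (OMap (comp_functor F D) j) (OMap F M) b h (AMap F (OMap D j) M (p j)) = q j"
      by blast
    have "hat M h = \<alpha>"
    proof (rule colimit_jointly_epi[OF p _ hat[OF M h(1)] \<alpha>])
      fix j assume j: "j \<in> Ob J"
      have "hat M h (a j) (x j) = \<alpha> (a j) (x j)"
        using h(2)[OF j] hat_app[OF a[OF j] x[OF j], of h] D[OF j] px[OF j] by (simp add: q_def)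
      then show "Comp ?M (OMap D j) M N (hat M h) (p j) = Comp ?M (OMap D j) M N \<alpha> (p j)"
        using yo_comp[OF ls M N y[OF a[OF j]] a[OF j] x[OF j] hat[OF M h(1)]]
          yo_comp[OF ls M N y[OF a[OF j]] a[OF j] x[OF j] \<alpha>] D[OF j] px[OF j] by simp
    qed (simp add: Mod_simps(1) N)
    then show ?thesis using h(1) by blast
  qed
  \<comment> \<open>As for every representation, the universal element corresponds to the identity of \<open>N\<close>.\<close>
  have NM: "N \<in> Ob ?M" using N by (simp add: Mod_simps(1))
  obtain e where e: "e \<in> Hom B (OMap F N) b" and hat_e: "hat N e = Ide ?M N"
    using hat_surj[OF N cat_Ide[OF M NM]] by blast
  have hat_ek: "hat P (Comp B (OMap F P) (OMap F N) b e (AMap F P N k)) = k"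
    if P: "is_model E S P" and k: "k \<in> Hom ?M P N" for P k
    using hat_natural[OF P N e k] hat_e cat_idl[OF M _ NM k] P by (simp add: Mod_simps(1))
  have "universal_arrow ?M B F b N e"
  proof (rule universal_arrowI[OF NM e])
    fix P h assume "P \<in> Ob ?M" and h: "h \<in> Hom B (OMap F P) b"
    then have P: "is_model E S P" by (simp add: Mod_simps(1))
    note k = hat[OF P h]
    have "Comp B (OMap F P) (OMap F N) b e (AMap F P N (hat P h)) = h"
      using hat_inj[OF P cat_Comp[OF B FO[OF P] FO[OF N] b FH[OF P N k] e] h] hat_ek[OF P k] by blast
    then show "\<exists>k\<in>Hom ?M P N. Comp B (OMap F P) (OMap F N) b e (AMap F P N k) = h"
      using k by blast
  next
    fix P k k' assume "P \<in> Ob ?M" and k: "k \<in> Hom ?M P N" "k' \<in> Hom ?M P N"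
      and eq: "Comp B (OMap F P) (OMap F N) b e (AMap F P N k) = Comp B (OMap F P) (OMap F N) b e (AMap F P N k')"
    then have P: "is_model E S P" by (simp add: Mod_simps(1))
    show "k = k'"
      using hat_ek[OF P k(1)] unfolding eq hat_ek[OF P k(2)] ..
  qed
  then show ?thesis by blast
qed

lemma strongly_compact_if_equivalent_to_Mod:
  fixes A E :: "('o, 'u::universe) cat"
  assumes sk: "limit_sketch E S" and real: "realized E S"
    and small: "\<And>M. is_model E S M \<Longrightarrow> small_model E S M"
    and eq: "equivalent_categories A (Mod E S)"
  shows "strongly_compact A"
  unfolding strongly_compact_def
proof (intro allI impI, elim conjE)
  fix B :: "('o, 'u) cat" and F
  assume B: "is_category B" "locally_small B" and F: "cocontinuous A B F"
  obtain H where H: "fully_faithful (Mod E S) A H" "essentially_surjective (Mod E S) A H"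
    using equivalent_categories_ff_eso[OF eq] .
  note Ff = cocontinuous_functor[OF F]
  show "is_left_adjoint A B F"
  proof (rule universal_arrows_left_adjoint[OF Ff])
    fix b assume b: "b \<in> Ob B"
    obtain r e where "universal_arrow (Mod E S) B (comp_functor F H) b r e"
      using Mod_universal_arrow[OF sk real small cocontinuous_comp_ff_eso[OF F H] B(2) b] by blast
    from universal_arrow_along_equivalence[OF H Ff this b]
    show "\<exists>r e. universal_arrow A B F b r e" by blast
  qed
qed

section \<open>Strongly compact categories\<close>

text \<open>The category with object set \<open>V\<close> and the hom-sets of \<open>C\<close> between the objects \<open>T v\<close>, renamed
  along injections \<open>enc\<close>. It turns a part of a category with large objects and morphisms into one
  that strong compactness can be tested against. Since hom-sets may overlap, \<open>enc\<close> can be chosen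
  for each of them separately.\<close>

definition full_image :: "('p, 'm) cat \<Rightarrow> 'o set \<Rightarrow> ('o \<Rightarrow> 'p) \<Rightarrow> ('p \<Rightarrow> 'p \<Rightarrow> 'm \<Rightarrow> 'u) \<Rightarrow> ('o, 'u) cat" where
  "full_image C V T enc = (let dec = (\<lambda>a b. inv_into (Hom C (T a) (T b)) (enc (T a) (T b))) in
    \<lparr>Ob = V, Hom = (\<lambda>a b. enc (T a) (T b) ` Hom C (T a) (T b)),
     Comp = (\<lambda>a b c g f. enc (T a) (T c) (Comp C (T a) (T b) (T c) (dec b c g) (dec a b f))),
     Ide = (\<lambda>a. enc (T a) (T a) (Ide C (T a)))\<rparr>)"

definition image_inclusion :: "('p, 'm) cat \<Rightarrow> ('o \<Rightarrow> 'p) \<Rightarrow> ('p \<Rightarrow> 'p \<Rightarrow> 'm \<Rightarrow> 'u) \<Rightarrow> ('o, 'u, 'p, 'm) fctr" where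
  "image_inclusion C T enc =
    \<lparr>OMap = T, AMap = (\<lambda>a b. inv_into (Hom C (T a) (T b)) (enc (T a) (T b)))\<rparr>"

lemma full_image_simps:
  "Ob (full_image C V T enc) = V"
  "Hom (full_image C V T enc) a b = enc (T a) (T b) ` Hom C (T a) (T b)"
  "Comp (full_image C V T enc) a b c g f = enc (T a) (T c) (Comp C (T a) (T b) (T c)
    (AMap (image_inclusion C T enc) b c g) (AMap (image_inclusion C T enc) a b f))"
  "Ide (full_image C V T enc) a = enc (T a) (T a) (Ide C (T a))"
  "OMap (image_inclusion C T enc) a = T a"
  by (simp_all add: full_image_def image_inclusion_def Let_def)

lemma image_inclusion_enc:
  assumes "inj_on (enc (T a) (T b)) (Hom C (T a) (T b))" "f \<in> Hom C (T a) (T b)"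
  shows "AMap (image_inclusion C T enc) a b (enc (T a) (T b) f) = f"
  using assms by (simp add: image_inclusion_def)

lemma image_inclusion_ff:
  assumes C: "is_category C" and T: "\<And>a. a \<in> V \<Longrightarrow> T a \<in> Ob C"
    and enc: "\<And>a b. a \<in> V \<Longrightarrow> b \<in> V \<Longrightarrow> inj_on (enc (T a) (T b)) (Hom C (T a) (T b))"
  shows "fully_faithful (full_image C V T enc) C (image_inclusion C T enc)"
proof -
  let ?B = "full_image C V T enc" and ?Q = "AMap (image_inclusion C T enc)"
  have dec: "?Q a b (enc (T a) (T b) f) = f"
    if "a \<in> V" "b \<in> V" "f \<in> Hom C (T a) (T b)" for a b f
    using that enc by (intro image_inclusion_enc) auto
  have B: "is_category ?B"
    unfolding is_category_def full_image_simps
    by (auto simp: dec T C cat_Comp cat_Ide cat_idl cat_idr cat_assoc)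
  show ?thesis
  proof (rule fully_faithfulI)
    show "is_functor ?B C (image_inclusion C T enc)"
      unfolding is_functor_def full_image_simps
      by (auto simp: B C dec T cat_Comp cat_Ide)
  next
    fix a b g assume "a \<in> Ob ?B" "b \<in> Ob ?B" and
      g: "g \<in> Hom C (OMap (image_inclusion C T enc) a) (OMap (image_inclusion C T enc) b)"
    then show "\<exists>f\<in>Hom ?B a b. ?Q a b f = g"
      by (intro bexI[of _ "enc (T a) (T b) g"]) (auto simp: full_image_simps dec)
  qed (auto simp: full_image_simps dec)
qed

lemma is_cocone_cong:
  assumes D': "is_functor J C D'" and D: "\<And>j. j \<in> Ob J \<Longrightarrow> OMap D' j = OMap D j"
    "\<And>i j u. i \<in> Ob J \<Longrightarrow> j \<in> Ob J \<Longrightarrow> u \<in> Hom J i j \<Longrightarrow> AMap D' i j u = AMap D i j u"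
    and p: "\<And>j. j \<in> Ob J \<Longrightarrow> p' j = p j" and c: "is_cocone C J D a p"
  shows "is_cocone C J D' a p'"
  unfolding is_cocone_def using assms(1-4) coconeD[OF c] by simp

text \<open>Diagrams that agree on the index category may still differ as records.\<close>

lemma is_colimit_cocone_cong:
  assumes D': "is_functor J C D'" and D: "\<And>j. j \<in> Ob J \<Longrightarrow> OMap D' j = OMap D j"
    "\<And>i j u. i \<in> Ob J \<Longrightarrow> j \<in> Ob J \<Longrightarrow> u \<in> Hom J i j \<Longrightarrow> AMap D' i j u = AMap D i j u"
    and p: "\<And>j. j \<in> Ob J \<Longrightarrow> p' j = p j" and c: "is_colimit_cocone C J D a p"
  shows "is_colimit_cocone C J D' a p'"
proof (rule colimit_coconeI)
  note cc = colimit_cocone[OF c]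
  show "is_cocone C J D' a p'" using is_cocone_cong[OF D' D p cc] .
  { fix b q assume q: "is_cocone C J D' b q"
    have "is_cocone C J D b q"
      by (rule is_cocone_cong[OF coconeD(2)[OF cc] _ _ _ q]) (simp_all add: D)
    from colimit_factor[OF c this] obtain h where "h \<in> Hom C a b"
      "\<And>j. j \<in> Ob J \<Longrightarrow> Comp C (OMap D j) a b h (p j) = q j" by blast
    then show "\<exists>h\<in>Hom C a b. \<forall>j\<in>Ob J. Comp C (OMap D' j) a b h (p' j) = q j"
      by (intro bexI[of _ h]) (simp_all add: D p) }
  { fix b g h assume gh: "b \<in> Ob C" "g \<in> Hom C a b" "h \<in> Hom C a b"
      and eq: "\<And>j. j \<in> Ob J \<Longrightarrow> Comp C (OMap D' j) a b g (p' j) = Comp C (OMap D' j) a b h (p' j)"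
    show "g = h"
    proof (rule colimit_jointly_epi[OF c gh])
      fix j assume "j \<in> Ob J"
      with eq[OF this] show "Comp C (OMap D j) a b g (p j) = Comp C (OMap D j) a b h (p j)"
        by (simp only: D(1) p)
    qed }
qed

text \<open>The functor that \<open>M\<close> induces from \<open>A\<close> to the full image of \<open>op SetCat\<close> on the sets \<open>M a\<close> and one
  additional one-point set is cocontinuous, hence a left adjoint. Its universal arrow to the
  one-point set is a function from that set to some \<open>M r\<close>, that is, an element of \<open>M r\<close>, and the
  universal property of the arrow says that this element represents \<open>M\<close>.\<close>

lemma strongly_compact_representable:
  fixes A :: "('o, 'u::universe) cat" and M :: "('o, 'u, 'u set, 'u \<Rightarrow> 'u) fctr"
  assumes inf: "(UNIV :: 'u set) \<lesssim> (UNIV :: 'o set)"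
    and sc: "strongly_compact A" and A: "is_category A"
    and M: "is_functor (op A) SetCat M"
    and lim: "\<And>(J :: ('u, 'u) cat) D a p. is_limit_cone (op A) J D a p \<Longrightarrow>
      is_limit_cone SetCat J (comp_functor M D) (OMap M a) (\<lambda>j. AMap M a (OMap D j) (p j))"
  obtains r x where "r \<in> Ob A" "x \<in> OMap M r"
    "\<And>a y. a \<in> Ob A \<Longrightarrow> y \<in> OMap M a \<Longrightarrow> \<exists>!f. f \<in> Hom A a r \<and> AMap M r a f x = y"
proof -
  let ?C = "op SetCat :: ('u set, 'u \<Rightarrow> 'u) cat"
  define G where "G = op_functor M"
  have G: "is_functor A ?C G"
    using op_functor_is_functor[OF M] by (simp add: G_def)
  have G_simps: "OMap G a = OMap M a" "AMap G a b f = AMap M b a f" for a b f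
    by (simp_all add: G_def)
  have C: "is_category ?C" by (rule op_category[OF SetCat_category])
  have "infinite (UNIV :: 'o set)"
    using infinite_universe inf by (meson infinite_le_lepoll lepoll_trans)
  \<comment> \<open>As \<open>'o\<close> is infinite, its elements can be moved to leave a name \<open>z\<close> for the one-point set.\<close>
  then obtain s :: "'o \<Rightarrow> 'o" and z where s: "inj s" and z: "z \<notin> range s"
    unfolding infinite_iff_psubset eqpoll_def bij_betw_def by blast
  define pt :: 'u where "pt = undefined"
  define T where "T b = (if b = z then {pt} else OMap M (inv s b))" for b
  define V where "V = insert z (s ` Ob A)"
  have Tz: "T z = {pt}" and Ts: "T (s a) = OMap M a" for a
    using z by (auto simp: T_def inv_f_f[OF s])
  have T: "T b \<in> Ob ?C" if "b \<in> V" for b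
    using that functor_Ob[OF M] by (auto simp: V_def Tz Ts small_finite)
  have "\<exists>e :: ('u \<Rightarrow> 'u) \<Rightarrow> 'u. small X \<longrightarrow> small Y \<longrightarrow> inj_on e (Y \<rightarrow>\<^sub>E X)" for X Y :: "'u set"
    using small_function_space[of Y X] lesspoll_imp_lepoll unfolding lepoll_def by blast
  then obtain enc :: "'u set \<Rightarrow> 'u set \<Rightarrow> ('u \<Rightarrow> 'u) \<Rightarrow> 'u"
    where enc: "\<And>X Y. small X \<Longrightarrow> small Y \<Longrightarrow> inj_on (enc X Y) (Y \<rightarrow>\<^sub>E X)"
    by metis
  have enc': "inj_on (enc (T a) (T b)) (Hom ?C (T a) (T b))" if "a \<in> V" "b \<in> V" for a b
    using enc T[OF that(1)] T[OF that(2)] by simp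
  define B where "B = full_image ?C V T enc"
  define Q where "Q = image_inclusion ?C T enc"
  note B_simps = full_image_simps(1-4)[of ?C V T enc, folded B_def Q_def]
  have Q: "fully_faithful B ?C Q"
    unfolding B_def Q_def by (rule image_inclusion_ff[where T = T and enc = enc, OF C T enc'])
  note Qf = ff_functor[OF Q]
  have B: "is_category B" using functor_dom[OF Qf] .
  have QO: "OMap Q a = T a" for a by (simp add: Q_def full_image_simps)
  have Q_enc: "AMap Q a b (enc (T a) (T b) f) = f" if "a \<in> V" "b \<in> V" "f \<in> Hom ?C (T a) (T b)" for a b f
    unfolding Q_def by (rule image_inclusion_enc[of enc T, OF enc'[OF that(1,2)] that(3)])
  have "small (Hom B a b)" if "a \<in> V" "b \<in> V" for a b
    using small_function_space[of "T b" "T a"] T[OF that(1)] T[OF that(2)]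
      lesspoll_trans1[OF image_lepoll] by (auto simp: B_simps small_def)
  then have lsB: "locally_small B" by (simp add: locally_small_def B_simps)
  define F where "F = \<lparr>OMap = s, AMap = (\<lambda>a b f. enc (OMap M a) (OMap M b) (AMap G a b f))\<rparr>"
  have FO: "OMap F a = s a" for a by (simp add: F_def)
  have sO: "s a \<in> V" if "a \<in> Ob A" for a using that by (simp add: V_def)
  have zO: "z \<in> V" by (simp add: V_def)
  have GH: "AMap G a b f \<in> Hom ?C (T (s a)) (T (s b))" if "a \<in> Ob A" "b \<in> Ob A" "f \<in> Hom A a b" for a b f
    using functor_Hom[OF G that] by (simp add: Ts G_simps)
  have FA: "AMap F a b f = enc (T (s a)) (T (s b)) (AMap G a b f)" for a b f
    by (simp add: F_def Ts)
  have QF: "AMap Q (s a) (s b) (AMap F a b f) = AMap G a b f" if "a \<in> Ob A" "b \<in> Ob A" "f \<in> Hom A a b" for a b f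
    unfolding FA using Q_enc[OF sO sO GH] that by blast
  have F: "is_functor A B F"
    unfolding is_functor_def
  proof (intro conjI ballI A B)
    fix a assume a: "a \<in> Ob A"
    show "OMap F a \<in> Ob B" using sO[OF a] by (simp add: FO B_simps)
    show "AMap F a a (Ide A a) = Ide B (OMap F a)"
      unfolding FA functor_Ide[OF G a] by (simp add: FO B_simps Ts G_simps(1))
  next
    fix a b f assume "a \<in> Ob A" "b \<in> Ob A" "f \<in> Hom A a b"
    then show "AMap F a b f \<in> Hom B (OMap F a) (OMap F b)"
      using GH by (simp add: FO FA B_simps)
  next
    fix a b c f g assume "a \<in> Ob A" "b \<in> Ob A" "c \<in> Ob A" "f \<in> Hom A a b" "g \<in> Hom A b c"
    then show "AMap F a c (Comp A a b c g f) =
        Comp B (OMap F a) (OMap F b) (OMap F c) (AMap F b c g) (AMap F a b f)"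
      unfolding FO B_simps(3) FA[of a c] by (simp add: QF functor_Comp[OF G] Ts G_simps(1))
  qed
  have "cocontinuous A B F"
    unfolding cocontinuous_def
  proof (intro conjI F allI impI)
    fix J :: "('u, 'u) cat" and D a p assume p: "is_colimit_cocone A J D a p"
    note cp = coconeD[OF colimit_cocone[OF p]]
    have "is_limit_cone (op A) (op J) (op_functor D) a p"
      using p by (simp add: op_limit_cone)
    from lim[OF this] have Gp: "is_colimit_cocone ?C J (comp_functor G D) (OMap G a) (\<lambda>j. AMap G (OMap D j) a (p j))"
      unfolding op_limit_cone[of ?C J "comp_functor G D", symmetric]
      by (simp add: G_simps) (simp add: G_def op_functor_comp)
    show "is_colimit_cocone B J (comp_functor F D) (OMap F a) (\<lambda>j. AMap F (OMap D j) a (p j))"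
    proof (rule ff_reflects_colimit[OF Q functor_cocone[OF F colimit_cocone[OF p]]])
      have "is_colimit_cocone ?C J (comp_functor Q (comp_functor F D)) (OMap G a)
          (\<lambda>j. AMap Q (OMap (comp_functor F D) j) (OMap F a) (AMap F (OMap D j) a (p j)))"
      proof (rule is_colimit_cocone_cong[OF _ _ _ _ Gp])
        show "is_functor J ?C (comp_functor Q (comp_functor F D))"
          by (intro comp_functor_is_functor[OF _ Qf] comp_functor_is_functor[OF cp(2) F])
      qed (use functor_Ob[OF cp(2)] functor_Hom[OF cp(2)] cp(3,4) in
          \<open>simp_all add: FO QF QO Ts G_simps(1)\<close>)
      then show "is_colimit_cocone ?C J (comp_functor Q (comp_functor F D)) (OMap Q (OMap F a))
          (\<lambda>j. AMap Q (OMap (comp_functor F D) j) (OMap F a) (AMap F (OMap D j) a (p j)))"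
        by (simp add: FO QO Ts G_simps(1))
    qed
  qed
  then have "is_left_adjoint A B F"
    using sc B lsB unfolding strongly_compact_def by blast
  then obtain r e where u: "universal_arrow A B F z r e"
    using left_adjoint_universal_arrow zO by (metis B_simps(1))
  note r = universal_arrowD(1)[OF u]
  have "e \<in> enc (T (s r)) (T z) ` ({pt} \<rightarrow>\<^sub>E OMap M r)"
    using universal_arrowD(2)[OF u] by (simp add: FO B_simps Tz Ts)
  then obtain \<epsilon> where \<epsilon>: "\<epsilon> \<in> {pt} \<rightarrow>\<^sub>E OMap M r" and e: "e = enc (T (s r)) (T z) \<epsilon>" by blast
  have Qe: "AMap Q (s r) z e = \<epsilon>"
    unfolding e using Q_enc[OF sO[OF r] zO] \<epsilon> by (simp add: Ts Tz)
  show thesis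
  proof (rule that[OF r])
    show "\<epsilon> pt \<in> OMap M r" using \<epsilon> by auto
    fix a y assume a: "a \<in> Ob A" and y: "y \<in> OMap M a"
    define h where "h = enc (T (s a)) (T z) (\<lambda>t\<in>{pt}. y)"
    have h: "h \<in> Hom B (OMap F a) z"
      using y by (auto simp: h_def FO B_simps Ts Tz)
    have "Comp B (OMap F a) (OMap F r) z e (AMap F a r f) = h \<longleftrightarrow> AMap M r a f (\<epsilon> pt) = y"
      if f: "f \<in> Hom A a r" for f
    proof -
      have Mf: "AMap M r a f \<in> OMap M r \<rightarrow>\<^sub>E OMap M a"
        using GH[OF a r f] by (simp add: Ts G_simps)
      have c: "compose {pt} (AMap M r a f) \<epsilon> \<in> {pt} \<rightarrow>\<^sub>E OMap M a"
        using compose_PiE[OF \<epsilon> Mf] .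
      have "Comp B (OMap F a) (OMap F r) z e (AMap F a r f) =
          enc (T (s a)) (T z) (compose {pt} (AMap M r a f) \<epsilon>)"
        by (simp add: FO B_simps(3) Qe QF[OF a r f] Ts Tz G_simps)
      then have "Comp B (OMap F a) (OMap F r) z e (AMap F a r f) = h \<longleftrightarrow>
          compose {pt} (AMap M r a f) \<epsilon> = (\<lambda>t\<in>{pt}. y)"
        using inj_on_eq_iff[OF enc'[OF sO[OF a] zO], of "compose {pt} (AMap M r a f) \<epsilon>" "\<lambda>t\<in>{pt}. y"] c y
        by (auto simp: h_def Ts Tz)
      also have "\<dots> \<longleftrightarrow> AMap M r a f (\<epsilon> pt) = y"
        by (auto simp: compose_def fun_eq_iff)
      finally show ?thesis .
    qed
    moreover have "\<exists>!f. f \<in> Hom A a r \<and> Comp B (OMap F a) (OMap F r) z e (AMap F a r f) = h"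
      using u a h unfolding universal_arrow_def by blast
    ultimately show "\<exists>!f. f \<in> Hom A a r \<and> AMap M r a f (\<epsilon> pt) = y"
      by (metis (no_types, lifting))
  qed
qed

definition point_category :: "('u, 'u) cat" where
  "point_category = \<lparr>Ob = {undefined}, Hom = (\<lambda>_ _. {undefined}), Comp = (\<lambda>_ _ _ _ _. undefined),
    Ide = (\<lambda>_. undefined)\<rparr>"

lemma point_category_small: "small_category (point_category :: ('u::universe, 'u) cat)"
  by (simp add: small_category_def is_category_def locally_small_def point_category_def small_finite)

lemma iso_point_colimit:
  fixes i :: 'm
  assumes C: "is_category C" and a: "a \<in> Ob C" and m: "m \<in> Ob C" and i: "is_iso C a m i"
  shows "is_colimit_cocone C (point_category :: ('u::universe, 'u) cat)
    \<lparr>OMap = (\<lambda>_. a), AMap = (\<lambda>_ _ _. Ide C a)\<rparr> m (\<lambda>_. i)"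
proof (rule colimit_coconeI)
  obtain i' where ii: "i \<in> Hom C a m" "i' \<in> Hom C m a" "Comp C a m a i' i = Ide C a"
    using i by (rule isoE)
  let ?J = "point_category :: ('u, 'u) cat" and ?D = "\<lparr>OMap = (\<lambda>_. a), AMap = (\<lambda>_ _ _. Ide C a)\<rparr>"
  have J: "small_category ?J" by (rule point_category_small)
  then have "is_category ?J" unfolding small_category_def ..
  then have D: "is_functor ?J C ?D"
    using C a by (simp add: is_functor_def cat_Ide cat_idl)
  then show "is_cocone C ?J ?D m (\<lambda>_. i)"
    using C a m ii J by (simp add: is_cocone_def cat_idr)
  { fix b q assume q: "is_cocone C ?J ?D b q"
    note q = coconeD[OF q]
    have q1: "q j \<in> Hom C a b" if "j \<in> Ob ?J" for j using q(4)[OF that] by simp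
    have "Comp C a m b (Comp C m a b (q undefined) i') i = q j" if "j \<in> Ob ?J" for j
      using that q1[OF that] C a m q(3) ii
      by (simp add: point_category_def cat_assoc[symmetric] cat_idr)
    moreover have "Comp C m a b (q undefined) i' \<in> Hom C m b"
      using C a m q(3) ii q1[of undefined] by (auto simp: point_category_def intro: cat_Comp)
    ultimately show "\<exists>h\<in>Hom C m b. \<forall>j\<in>Ob ?J. Comp C (OMap ?D j) m b h i = q j" by auto }
  { fix b g h assume "b \<in> Ob C" "g \<in> Hom C m b" "h \<in> Hom C m b"
      "\<And>j. j \<in> Ob ?J \<Longrightarrow> Comp C (OMap ?D j) m b g i = Comp C (OMap ?D j) m b h i"
    then show "g = h" using iso_epi[OF C a m _ i] by (simp add: point_category_def) }
qed

text \<open>The sketch consists of all limit cones of \<open>op A\<close>. Its models are representable, so the Yoneda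
  embedding of \<open>A\<close> is essentially surjective.\<close>

lemma strongly_compact_equivalent_to_Mod:
  fixes A :: "('o, 'u::universe) cat"
  assumes inf: "(UNIV :: 'u set) \<lesssim> (UNIV :: 'o set)"
    and A: "is_category A" and ls: "locally_small A" and sc: "strongly_compact A"
  shows "\<exists>(E :: ('o, 'u) cat) (S :: ('o, 'u) cone set).
      limit_sketch E S \<and> realized E S \<and>
      (\<forall>M. is_model E S M \<longrightarrow> small_model E S M) \<and>
      equivalent_categories A (Mod E S)"
proof (intro exI conjI allI impI)
  define E where "E = op A"
  define S :: "('o, 'u) cone set" where "S = {(J, D, a, p). is_limit_cone E J D a p}"
  have E: "is_category E" and lsE: "locally_small E"
    using A ls by (simp_all add: E_def op_category op_locally_small)
  show "limit_sketch E S"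
    using E lsE limit_cone by (auto simp: limit_sketch_def S_def)
  show real: "realized E S"
    unfolding realized_def is_model_def
    using hom_functor_is_functor[OF E lsE] hom_functor_preserves_limit[OF E lsE]
    by (auto simp: S_def)
  have rep: "\<exists>a\<in>Ob E. \<exists>i. is_iso (Mod E S) (hom_functor E a) M i" if M: "is_model E S M" for M
  proof -
    note Mf = is_model_functor[OF M]
    have "is_limit_cone SetCat J (comp_functor M D) (OMap M a) (\<lambda>j. AMap M a (OMap D j) (p j))"
      if "is_limit_cone (op A) J D a p" for J :: "('u, 'u) cat" and D a p
      using M that by (auto simp: is_model_def S_def E_def)
    from strongly_compact_representable[OF inf sc A Mf[unfolded E_def] this]
    obtain r x where r: "r \<in> Ob E" and x: "x \<in> OMap M r"
      and bij: "\<And>a y. a \<in> Ob E \<Longrightarrow> y \<in> OMap M a \<Longrightarrow> \<exists>!f. f \<in> Hom E r a \<and> AMap M r a f x = y"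
      by (auto simp: E_def)
    have "bij_betw (yo E M r x a) (OMap (hom_functor E r) a) (OMap M a)" if a: "a \<in> Ob E" for a
      unfolding bij_betw_def hom_functor_simps
    proof
      have MO: "AMap M r a f x \<in> OMap M a" if "f \<in> Hom E r a" for f
        using set_functor_app[OF Mf r a that x] .
      show "inj_on (yo E M r x a) (Hom E r a)"
        using bij[OF a] MO by (intro inj_onI) (simp add: yo_app[OF a], metis)
      show "yo E M r x a ` Hom E r a = OMap M a"
      proof
        show "yo E M r x a ` Hom E r a \<subseteq> OMap M a" using MO by (auto simp: yo_app[OF a])
        show "OMap M a \<subseteq> yo E M r x a ` Hom E r a"
        proof
          fix y assume "y \<in> OMap M a"
          then obtain f where f: "f \<in> Hom E r a" "AMap M r a f x = y" using bij[OF a] by blast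
          then have "y = yo E M r x a f" by (simp add: yo_app[OF a])
          then show "y \<in> yo E M r x a ` Hom E r a" using f(1) by (rule image_eqI)
        qed
      qed
    qed
    then have "is_iso (Mod E S) (hom_functor E r) M (yo E M r x)"
      by (rule Mod_bij_iso[OF hom_functor_is_functor[OF E lsE r] Mf yo_hom[OF lsE Mf r x]])
    then show ?thesis using r by blast
  qed
  show "small_model E S M" if M: "is_model E S M" for M
  proof -
    obtain a i where a: "a \<in> Ob E" and i: "is_iso (Mod E S) (hom_functor E a) M i"
      using rep[OF M] by blast
    have "hom_functor E a \<in> Ob (Mod E S)" "M \<in> Ob (Mod E S)"
      using real a M by (auto simp: realized_def Mod_simps(1))
    from iso_point_colimit[OF Mod_category[OF E] this i]
    show ?thesis unfolding small_model_def using a by (intro exI conjI) auto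
  qed
  have "essentially_surjective A (Mod E S) (yoneda E)"
    using rep unfolding essentially_surjective_def by (auto simp: Mod_simps(1) E_def)
  moreover have "fully_faithful A (Mod E S) (yoneda E)"
    using yoneda_ff[OF E lsE real] by (simp add: E_def)
  ultimately show "equivalent_categories A (Mod E S)"
    by (rule ff_eso_equivalent_categories[rotated])
qed

theorem proposition1p2:
  fixes A :: "('o, 'u::universe) cat"
  assumes "(UNIV :: 'u set) \<lesssim> (UNIV :: 'o set)"
    and "is_category A" and "locally_small A"
  shows "strongly_compact A \<longleftrightarrow>
    (\<exists>(E :: ('o, 'u) cat) (S :: ('o, 'u) cone set).
      limit_sketch E S \<and> realized E S \<and>
      (\<forall>M. is_model E S M \<longrightarrow> small_model E S M) \<and>
      equivalent_categories A (Mod E S))"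
  using strongly_compact_equivalent_to_Mod[OF assms] strongly_compact_if_equivalent_to_Mod by blast

end
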